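(* Let $R=\mathbb{C}[\partial]\otimes\mathrm{span}_{\mathbb{C}}\{u_i\}_{i\in I}\oplus E_C$ be a Lie conformal algebra, where $\{u_i\}_{i\in I}$ is a linearly independent set of homogeneous elements and $E_C$ is the central extension part with $\partial E_C=0$. Let $J,\bar J\subset I$ with $I=J\sqcup\bar J$. Let $\bar R=\mathbb{C}[\partial]\otimes\mathrm{span}_{\mathbb{C}}\{v_i\}_{i\in I}$ be a $\mathbb{C}[\partial]$-module with $\{v_i\}_{i\in I}$ linearly independent and $p(v_i)=1-p(u_i)$ for all $i\in I$, let $\widetilde R=R\oplus\bar R$, and let $D$ be the odd endomorphism of $\widetilde R$ such that $[D,D]=2\partial$, $D(u_j)=v_j$ for $j\in J$, $D(v_{\bar\jmath})=u_{\bar\jmath}$ for $\bar\jmath\in\bar J$, and $D(E_C)=0$. Suppose the $\lambda$-brackets between any two elements of $\{u_i,v_i\}_{i\in I}$ are given so that $\widetilde R$ is a Lie conformal algebra (containing $R$, with $E_C$ central). If $S=\{u_i\mid i\in J\}\cup\{v_i\mid i\in\bar J\}$ is a supersymmetric generator in the $D$-direction, then $V(\widetilde R)$ is an $N=1$ SUSY vertex algebra with the odd derivation $D$.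
   Context: Everything is over $\mathbb{C}$, $\mathbb{Z}/2\mathbb{Z}$-graded, $p$ is parity. Supersymmetric generator: for a $\mathbb{C}[\partial]$-module with a $\lambda$-bracket and an odd endomorphism $D$ with $[D,D]=2\partial$, a subset $S$ is a supersymmetric generator in the $D$-direction (equivalently, $(S,D)$ satisfies the supersymmetric extension formulas) if for all $x,y\in S$ (SEF1) $[Dx\,{}_\lambda\,Dy]=(-1)^{p(x)+1}\big(D[Dx\,{}_\lambda\,y]+\lambda[x\,{}_\lambda\,y]\big)$, (SEF2) $[x\,{}_\lambda\,Dy]=(-1)^{p(x)+1}\big([Dx\,{}_\lambda\,y]-D[x\,{}_\lambda\,y]\big)$, where $D$ commutes with $\lambda$. Lie conformal algebra: a $\mathbb{Z}/2\mathbb{Z}$-graded $\mathbb{C}[\partial]$-module $R$ with a parity-preserving $\mathbb{C}$-linear map $R\otimes R\to\mathbb{C}[\lambda]\otimes R$, $[a\,{}_\lambda\,b]=\sum_{m\ge0}\frac{\lambda^m}{m!}a_{(m)}b$, with $[\partial a\,{}_\lambda\,b]=-\lambda[a\,{}_\lambda\,b]$, $[a\,{}_\lambda\,\partial b]=(\partial+\lambda)[a\,{}_\lambda\,b]$, $[b\,{}_\lambda\,a]=(-1)^{p(a)p(b)+1}[a\,{}_{-\partial-\lambda}\,b]$, $[a\,{}_\lambda[b\,{}_\gamma\,c]]=[[a\,{}_\lambda\,b]\,{}_{\lambda+\gamma}\,c]+(-1)^{p(a)p(b)}[b\,{}_\gamma[a\,{}_\lambda\,c]]$. Vertex algebra: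 a tuple $(V,\partial,[\,{}_\lambda\,],|0\rangle,:\ :)$ with $(V,\partial,[\,{}_\lambda\,])$ a Lie conformal algebra, $(V,\partial,|0\rangle,:\ :)$ a unital differential superalgebra, and (writing $a_{(-m-1)}b=\frac1{m!}:(\partial^ma)b:$) $:ab:-(-1)^{p(a)p(b)}:ba:=\int_{-\partial}^0[a\,{}_\lambda\,b]d\lambda$; $::ab:c:-:a:bc::=\sum_{j\ge0}a_{(-j-2)}(b_{(j)}c)+(-1)^{p(a)p(b)}\sum_{j\ge0}b_{(-j-2)}(a_{(j)}c)$; $[a\,{}_\lambda:bc:]=:[a\,{}_\lambda\,b]c:+(-1)^{p(a)p(b)}:b[a\,{}_\lambda\,c]:+\int_0^\lambda[[a\,{}_\lambda\,b]\,{}_\gamma\,c]d\gamma$. Universal enveloping vertex algebra $V(\widetilde R)$: the vertex algebra freely generated by $\widetilde R$, i.e. $\widetilde R\subset V(\widetilde R)$ compatibly with $\partial$ and $\lambda$-brackets, and for an ordered homogeneous basis $\{r_i\}$ of $\widetilde R$ the right-nested normally ordered monomials $r_{i_1}\cdots r_{i_l}$ ($i_1\le\dots\le i_l$, strict after odd elements) form a basis. $D$ is extended to $V(\widetilde R)$ as an odd derivation of the normally ordered product. $N=1$ SUSY vertex algebra: a tuple $(V,\nabla=(\partial,D),[\,{}_\Lambda\,],|0\rangle,:\ :)$, $D$ odd, $D^2=\partial$; $\Lambda=(\lambda,\chi)$ with $\lambda$ even central, $\chi$ odd, $\chi^2=-\lambda$, $D\chi+\chi D=2\lambda$, $D\lambda=\lambda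 D$ ($\Gamma=(\gamma,\eta)$ a second supercommuting copy); $[\,{}_\Lambda\,]:V\otimes V\to\mathbb{C}[\Lambda]\otimes V$ is odd and $\mathbb{C}$-linear, supercommutes with the formal variables, and satisfies $[Da\,{}_\Lambda\,b]=\chi[a\,{}_\Lambda\,b]$, $[a\,{}_\Lambda\,Db]=(-1)^{p(a)+1}(D+\chi)[a\,{}_\Lambda\,b]$, $[b\,{}_\Lambda\,a]=(-1)^{p(a)p(b)}[a\,{}_{-\nabla-\Lambda}\,b]$, $[a\,{}_\Lambda[b\,{}_\Gamma\,c]]=(-1)^{p(a)+1}[[a\,{}_\Lambda\,b]\,{}_{\Lambda+\Gamma}\,c]+(-1)^{(p(a)+1)(p(b)+1)}[b\,{}_\Gamma[a\,{}_\Lambda\,c]]$; $(V,\partial,D,|0\rangle,:\ :)$ is a unital differential superalgebra; quasi-commutativity and quasi-associativity hold as for vertex algebras with $[a\,{}_\lambda\,b]$ the coefficient of $\chi$ in $[a\,{}_\Lambda\,b]$ (written with $\chi$ on the left); and $[a\,{}_\Lambda:bc:]=:[a\,{}_\Lambda\,b]c:+(-1)^{(p(a)+1)p(b)}:b[a\,{}_\Lambda\,c]:+\partial_\eta\int_0^\lambda[[a\,{}_\Lambda\,b]\,{}_\Gamma\,c]d\gamma$. A vertex algebra $V$ is called an $N=1$ SUSY vertex algebra with the odd derivation $D$ if $[a\,{}_\Lambda\,b]:=[Da\,{}_\lambda\,b]+\chi[a\,{}_\lambda\,b]$ makes it one, with its given $\lambda$-bracket, product, vacuum and $\partial$. *)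

theory Defs
  imports Complex_Main "HOL-Library.Z2" "HOL-Library.Product_Plus"
    "HOL-Computational_Algebra.Polynomial"
begin

section \<open>Super vector spaces\<close>

text \<open>Parities live in the field \<^typ>\<open>bit\<close> of integers mod 2, so \<open>gr 0\<close> and \<open>gr 1\<close> are the even
  and the odd part. Axioms involving \<open>p(a)\<close> are imposed on homogeneous elements.\<close>

definition psign :: "bit \<Rightarrow> 'a::ab_group_add \<Rightarrow> 'a" where
  "psign p x = (if p = 0 then x else - x)"

locale super_vector_space = vector_space s
  for s :: "complex \<Rightarrow> 'v::ab_group_add \<Rightarrow> 'v" +
  fixes gr :: "bit \<Rightarrow> 'v set"
  assumes gr_subspace: "subspace (gr p)"
    and gr_disjoint: "gr 0 \<inter> gr 1 = {0}"
    and gr_decomp: "\<exists>y\<in>gr 0. \<exists>z\<in>gr 1. x = y + z"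

definition graded_subspace ::
  "(complex \<Rightarrow> 'v::ab_group_add \<Rightarrow> 'v) \<Rightarrow> (bit \<Rightarrow> 'v set) \<Rightarrow> 'v set \<Rightarrow> bool" where
  "graded_subspace s gr M \<longleftrightarrow> module.subspace s M \<and>
     (\<forall>x\<in>M. \<exists>y\<in>M \<inter> gr 0. \<exists>z\<in>M \<inter> gr 1. x = y + z)"

definition linear_of_parity ::
  "bit \<Rightarrow> (complex \<Rightarrow> 'v::ab_group_add \<Rightarrow> 'v) \<Rightarrow> (bit \<Rightarrow> 'v set) \<Rightarrow>
    (complex \<Rightarrow> 'w::ab_group_add \<Rightarrow> 'w) \<Rightarrow> (bit \<Rightarrow> 'w set) \<Rightarrow> ('v \<Rightarrow> 'w) \<Rightarrow> bool" where
  "linear_of_parity k s gr s' gr' f \<longleftrightarrow>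
     Vector_Spaces.linear s s' f \<and> (\<forall>p. f ` gr p \<subseteq> gr' (p + k))"

definition internal_direct_sum :: "'v::ab_group_add set \<Rightarrow> 'v set \<Rightarrow> 'v set \<Rightarrow> bool" where
  "internal_direct_sum C A B \<longleftrightarrow> C = {x + y |x y. x \<in> A \<and> y \<in> B} \<and> A \<inter> B = {0}"

text \<open>The submodule \<open>\<complex>[\<partial>] \<otimes> span {w i | i \<in> I}\<close>; \<open>d_free\<close> says that it is indeed a tensor product,
  i.e. that the elements \<open>\<partial>\<^sup>n (w i)\<close> are pairwise distinct and linearly independent.\<close>

definition d_span ::
  "(complex \<Rightarrow> 'v::ab_group_add \<Rightarrow> 'v) \<Rightarrow> ('v \<Rightarrow> 'v) \<Rightarrow> ('i \<Rightarrow> 'v) \<Rightarrow> 'i set \<Rightarrow> 'v set" where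
  "d_span s d w I = module.span s ((\<lambda>(i, n). (d ^^ n) (w i)) ` (I \<times> (UNIV :: nat set)))"

definition d_free ::
  "(complex \<Rightarrow> 'v::ab_group_add \<Rightarrow> 'v) \<Rightarrow> ('v \<Rightarrow> 'v) \<Rightarrow> ('i \<Rightarrow> 'v) \<Rightarrow> 'i set \<Rightarrow> bool" where
  "d_free s d w I \<longleftrightarrow>
     inj_on (\<lambda>(i, n). (d ^^ n) (w i)) (I \<times> (UNIV :: nat set)) \<and>
     \<not> module.dependent s ((\<lambda>(i, n). (d ^^ n) (w i)) ` (I \<times> (UNIV :: nat set)))"

section \<open>Polynomials with coefficients in a vector space\<close>

text \<open>\<^typ>\<open>'v poly\<close> is \<open>\<complex>[\<lambda>] \<otimes> V\<close>: multiplication by \<open>\<lambda>\<close> is \<^term>\<open>pCons 0\<close>, and an endomorphism of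
  \<open>V\<close> commuting with \<open>\<lambda>\<close> acts by \<^const>\<open>map_poly\<close>.

  \<open>subst_lambda T f (\<Sum>m. \<lambda>\<^sup>m c\<^sub>m) = \<Sum>m. T\<^sup>m (f c\<^sub>m)\<close>: the operator \<open>T\<close> is substituted for \<open>\<lambda>\<close> and \<open>f\<close>
  is applied to the coefficients. All maps \<open>f\<close> used below are additive.\<close>

definition subst_lambda ::
  "('w \<Rightarrow> 'w) \<Rightarrow> ('v::zero \<Rightarrow> 'w::comm_monoid_add) \<Rightarrow> 'v poly \<Rightarrow> 'w" where
  "subst_lambda T f P = (\<Sum>m\<le>degree P. (T ^^ m) (f (coeff P m)))"

text \<open>\<open>pint s P\<close> is \<open>\<integral>\<^sub>0\<^sup>\<lambda> P(\<gamma>) d\<gamma>\<close>, and \<open>pint_lambda s\<close> performs \<open>\<integral>\<^sub>0\<^sup>\<lambda> d\<gamma>\<close> on \<open>\<complex>[\<lambda>, \<gamma>] \<otimes> V\<close>, given as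
  \<^typ>\<open>'v poly poly\<close> with outer variable \<open>\<lambda>\<close> and inner variable \<open>\<gamma>\<close>.\<close>

definition pint :: "(complex \<Rightarrow> 'v::ab_group_add \<Rightarrow> 'v) \<Rightarrow> 'v poly \<Rightarrow> 'v poly" where
  "pint s P = (\<Sum>n\<le>degree P. monom (s (1 / of_nat (n + 1)) (coeff P n)) (n + 1))"

definition pint_lambda :: "(complex \<Rightarrow> 'v::ab_group_add \<Rightarrow> 'v) \<Rightarrow> 'v poly poly \<Rightarrow> 'v poly" where
  "pint_lambda s Q = subst_lambda (pCons 0) (pint s) Q"

section \<open>Lie conformal algebras\<close>

text \<open>\<open>d\<close> is \<open>\<partial>\<close> and \<open>br a b\<close> is \<open>[a \<^sub>\<lambda> b]\<close>. Both sides of the Jacobi identity are elements of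
  \<open>\<complex>[\<lambda>, \<gamma>] \<otimes> R\<close>, i.e. of \<^typ>\<open>'v poly poly\<close> with outer variable \<open>\<lambda>\<close> and inner variable \<open>\<gamma>\<close>.\<close>

abbreviation (input) lam2 :: "'v::zero poly poly \<Rightarrow> 'v poly poly" where
  "lam2 \<equiv> pCons 0"

abbreviation (input) gam2 :: "'v::zero poly poly \<Rightarrow> 'v poly poly" where
  "gam2 \<equiv> map_poly (pCons 0)"

abbreviation (input) const2 :: "'v::zero \<Rightarrow> 'v poly poly" where
  "const2 x \<equiv> [:[:x:]:]"

locale lie_conformal_algebra = super_vector_space s gr
  for s :: "complex \<Rightarrow> 'v::ab_group_add \<Rightarrow> 'v" and gr +
  fixes d :: "'v \<Rightarrow> 'v" and br :: "'v \<Rightarrow> 'v \<Rightarrow> 'v poly"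
  assumes d_even: "linear_of_parity 0 s gr s gr d"
    and br_add_left: "br (a + a') b = br a b + br a' b"
    and br_add_right: "br a (b + b') = br a b + br a b'"
    and br_scale_left: "br (s k a) b = map_poly (s k) (br a b)"
    and br_scale_right: "br a (s k b) = map_poly (s k) (br a b)"
    and br_parity: "a \<in> gr p \<Longrightarrow> b \<in> gr q \<Longrightarrow> coeff (br a b) m \<in> gr (p + q)"
    and br_d_left: "br (d a) b = - pCons 0 (br a b)"
    and br_d_right: "br a (d b) = map_poly d (br a b) + pCons 0 (br a b)"
    and br_skew: "a \<in> gr p \<Longrightarrow> b \<in> gr q \<Longrightarrow>
      br b a = psign (p * q + 1)
        (subst_lambda (\<lambda>P. - map_poly d P - pCons 0 P) (\<lambda>x. [:x:]) (br a b))"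
    and br_jacobi: "a \<in> gr p \<Longrightarrow> b \<in> gr q \<Longrightarrow>
      subst_lambda gam2 (\<lambda>x. subst_lambda lam2 const2 (br a x)) (br b c) =
      subst_lambda lam2
        (\<lambda>x. subst_lambda (\<lambda>w. lam2 w + gam2 w) const2 (br x c)) (br a b) +
      psign (p * q) (subst_lambda lam2 (\<lambda>x. subst_lambda gam2 const2 (br b x)) (br a c))"

definition lie_conformal_subalgebra ::
  "(complex \<Rightarrow> 'v::ab_group_add \<Rightarrow> 'v) \<Rightarrow> (bit \<Rightarrow> 'v set) \<Rightarrow> ('v \<Rightarrow> 'v) \<Rightarrow>
    ('v \<Rightarrow> 'v \<Rightarrow> 'v poly) \<Rightarrow> 'v set \<Rightarrow> bool" where
  "lie_conformal_subalgebra s gr d br R \<longleftrightarrow>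
     graded_subspace s gr R \<and> d ` R \<subseteq> R \<and> (\<forall>a\<in>R. \<forall>b\<in>R. \<forall>m. coeff (br a b) m \<in> R)"

definition supersymmetric_generator ::
  "(bit \<Rightarrow> 'v::ab_group_add set) \<Rightarrow> ('v \<Rightarrow> 'v \<Rightarrow> 'v poly) \<Rightarrow> ('v \<Rightarrow> 'v) \<Rightarrow> 'v set \<Rightarrow> bool" where
  "supersymmetric_generator gr br D S \<longleftrightarrow>
     S \<subseteq> gr 0 \<union> gr 1 \<and>
     (\<forall>x\<in>S. \<forall>y\<in>S. \<forall>p. x \<in> gr p \<longrightarrow>
        br (D x) (D y) = psign (p + 1) (map_poly D (br (D x) y) + pCons 0 (br x y)) \<and>
        br x (D y) = psign (p + 1) (br (D x) y - map_poly D (br x y)))"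

section \<open>Vertex algebras\<close>

text \<open>\<open>nop a b\<close> is the normally ordered product \<open>:ab:\<close>. With \<open>[a \<^sub>\<lambda> b] = \<Sum>j. \<lambda>\<^sup>j / j! a\<^sub>(\<^sub>j\<^sub>) b\<close>,
  \<open>nth_prod s br j a b\<close> is \<open>a\<^sub>(\<^sub>j\<^sub>) b\<close> and \<open>neg_prod s d nop m a b\<close> is \<open>a\<^sub>(\<^sub>-\<^sub>m\<^sub>-\<^sub>1\<^sub>) b\<close>.\<close>

definition nth_prod ::
  "(complex \<Rightarrow> 'v::ab_group_add \<Rightarrow> 'v) \<Rightarrow> ('v \<Rightarrow> 'v \<Rightarrow> 'v poly) \<Rightarrow> nat \<Rightarrow> 'v \<Rightarrow> 'v \<Rightarrow> 'v" where
  "nth_prod s br j a b = s (fact j) (coeff (br a b) j)"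

definition neg_prod ::
  "(complex \<Rightarrow> 'v::ab_group_add \<Rightarrow> 'v) \<Rightarrow> ('v \<Rightarrow> 'v) \<Rightarrow> ('v \<Rightarrow> 'v \<Rightarrow> 'v) \<Rightarrow> nat \<Rightarrow>
    'v \<Rightarrow> 'v \<Rightarrow> 'v" where
  "neg_prod s d nop m a b = s (1 / fact m) (nop ((d ^^ m) a) b)"

definition odd_derivation ::
  "(complex \<Rightarrow> 'v::ab_group_add \<Rightarrow> 'v) \<Rightarrow> (bit \<Rightarrow> 'v set) \<Rightarrow> ('v \<Rightarrow> 'v \<Rightarrow> 'v) \<Rightarrow>
    ('v \<Rightarrow> 'v) \<Rightarrow> bool" where
  "odd_derivation s gr nop D \<longleftrightarrow> linear_of_parity 1 s gr s gr D \<and>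
     (\<forall>p. \<forall>a\<in>gr p. \<forall>b. D (nop a b) = nop (D a) b + psign p (nop a (D b)))"

locale unital_differential_superalgebra = super_vector_space s gr
  for s :: "complex \<Rightarrow> 'v::ab_group_add \<Rightarrow> 'v" and gr +
  fixes d :: "'v \<Rightarrow> 'v" and vac :: 'v and nop :: "'v \<Rightarrow> 'v \<Rightarrow> 'v"
  assumes d_linear: "linear_of_parity 0 s gr s gr d"
    and nop_add_left: "nop (a + a') b = nop a b + nop a' b"
    and nop_add_right: "nop a (b + b') = nop a b + nop a b'"
    and nop_scale_left: "nop (s k a) b = s k (nop a b)"
    and nop_scale_right: "nop a (s k b) = s k (nop a b)"
    and nop_parity: "a \<in> gr p \<Longrightarrow> b \<in> gr q \<Longrightarrow> nop a b \<in> gr (p + q)"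
    and vac_even: "vac \<in> gr 0"
    and vac_left: "nop vac a = a"
    and vac_right: "nop a vac = a"
    and d_derivation: "d (nop a b) = nop (d a) b + nop a (d b)"

text \<open>\<open>\<integral>\<^sub>-\<^sub>\<partial>\<^sup>0 [a \<^sub>\<lambda> b] d\<lambda>\<close> is minus the antiderivative \<open>pint\<close> evaluated at \<open>-\<partial>\<close>.\<close>

definition quasi_commutative ::
  "(complex \<Rightarrow> 'v::ab_group_add \<Rightarrow> 'v) \<Rightarrow> (bit \<Rightarrow> 'v set) \<Rightarrow> ('v \<Rightarrow> 'v) \<Rightarrow>
    ('v \<Rightarrow> 'v \<Rightarrow> 'v poly) \<Rightarrow> ('v \<Rightarrow> 'v \<Rightarrow> 'v) \<Rightarrow> bool" where
  "quasi_commutative s gr d br nop \<longleftrightarrow>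
     (\<forall>p q. \<forall>a\<in>gr p. \<forall>b\<in>gr q.
        nop a b - psign (p * q) (nop b a) =
        - subst_lambda (\<lambda>x. - d x) (\<lambda>x. x) (pint s (br a b)))"

definition quasi_associative ::
  "(complex \<Rightarrow> 'v::ab_group_add \<Rightarrow> 'v) \<Rightarrow> (bit \<Rightarrow> 'v set) \<Rightarrow> ('v \<Rightarrow> 'v) \<Rightarrow>
    ('v \<Rightarrow> 'v \<Rightarrow> 'v poly) \<Rightarrow> ('v \<Rightarrow> 'v \<Rightarrow> 'v) \<Rightarrow> bool" where
  "quasi_associative s gr d br nop \<longleftrightarrow>
     (\<forall>p q. \<forall>a\<in>gr p. \<forall>b\<in>gr q. \<forall>c.
        nop (nop a b) c - nop a (nop b c) =
        (\<Sum>j\<le>degree (br b c). neg_prod s d nop (j + 1) a (nth_prod s br j b c)) +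
        psign (p * q)
          (\<Sum>j\<le>degree (br a c). neg_prod s d nop (j + 1) b (nth_prod s br j a c)))"

locale vertex_algebra =
  lie_conformal_algebra s gr d br + unital_differential_superalgebra s gr d vac nop
  for s :: "complex \<Rightarrow> 'v::ab_group_add \<Rightarrow> 'v" and gr and d and br and vac and nop +
  assumes quasi_comm: "quasi_commutative s gr d br nop"
    and quasi_assoc: "quasi_associative s gr d br nop"
    and wick: "a \<in> gr p \<Longrightarrow> b \<in> gr q \<Longrightarrow>
      br a (nop b c) =
      map_poly (\<lambda>x. nop x c) (br a b) + psign (p * q) (map_poly (nop b) (br a c)) +
      pint_lambda s (map_poly (\<lambda>x. br x c) (br a b))"

text \<open>The universal enveloping vertex algebra \<open>V\<close> of a Lie conformal algebra \<open>R\<close>, with structure map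
  \<open>\<iota> : R \<rightarrow> V\<close>. The ordered homogeneous basis of \<open>R\<close> is a set \<open>B\<close> with a linear order \<open>r\<close> on it; a
  monomial is given by the list of its factors. Linear independence of the one-letter monomials
  \<open>:r\<^sub>i |0\<rangle>: = r\<^sub>i\<close> makes \<open>\<iota>\<close> injective.\<close>

definition nop_monomial :: "('v \<Rightarrow> 'v \<Rightarrow> 'v) \<Rightarrow> 'v \<Rightarrow> 'v list \<Rightarrow> 'v" where
  "nop_monomial nop vac xs = foldr nop xs vac"

definition pbw_lists :: "(bit \<Rightarrow> 'r set) \<Rightarrow> 'r set \<Rightarrow> ('r \<times> 'r) set \<Rightarrow> 'r list set" where
  "pbw_lists gr B r =
     {xs. set xs \<subseteq> B \<and> sorted_wrt (\<lambda>x y. (x, y) \<in> r \<and> (x \<in> gr 1 \<longrightarrow> x \<noteq> y)) xs}"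

locale universal_enveloping_vertex_algebra =
  R: lie_conformal_algebra s gr d br + V: vertex_algebra sV grV dV brV vac nop
  for s :: "complex \<Rightarrow> 'r::ab_group_add \<Rightarrow> 'r" and gr and d and br
    and sV :: "complex \<Rightarrow> 'v::ab_group_add \<Rightarrow> 'v" and grV and dV and brV and vac and nop +
  fixes \<iota> :: "'r \<Rightarrow> 'v"
  assumes incl_even: "linear_of_parity 0 s gr sV grV \<iota>"
    and incl_d: "\<iota> (d x) = dV (\<iota> x)"
    and incl_br: "brV (\<iota> x) (\<iota> y) = map_poly \<iota> (br x y)"
    and pbw: "\<exists>B r. B \<subseteq> gr 0 \<union> gr 1 \<and> \<not> module.dependent s B \<and> module.span s B = UNIV \<and>
      linear_order_on B r \<and>
      inj_on (\<lambda>xs. nop_monomial nop vac (map \<iota> xs)) (pbw_lists gr B r) \<and>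
      \<not> module.dependent sV ((\<lambda>xs. nop_monomial nop vac (map \<iota> xs)) ` pbw_lists gr B r) \<and>
      module.span sV ((\<lambda>xs. nop_monomial nop vac (map \<iota> xs)) ` pbw_lists gr B r) = UNIV"

section \<open>N=1 SUSY vertex algebras\<close>

text \<open>A pair \<open>(P\<^sub>0, P\<^sub>1)\<close> in \<^typ>\<open>'w poly \<times> 'w poly\<close> stands for \<open>P\<^sub>0(\<lambda>) + \<chi> P\<^sub>1(\<lambda>)\<close> in \<open>\<complex>[\<Lambda>] \<otimes> W\<close>, with
  \<open>\<chi>\<close> on the left and \<open>\<chi>\<^sup>2 = -\<lambda>\<close>.\<close>

type_synonym 'w spoly = "'w poly \<times> 'w poly"

fun times_lam :: "'w::ab_group_add spoly \<Rightarrow> 'w spoly" where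
  "times_lam (P0, P1) = (pCons 0 P0, pCons 0 P1)"

fun times_chi :: "'w::ab_group_add spoly \<Rightarrow> 'w spoly" where
  "times_chi (P0, P1) = (- pCons 0 P1, P0)"

definition spoly_const :: "'w::ab_group_add \<Rightarrow> 'w spoly" where
  "spoly_const w = ([:w:], 0)"

text \<open>The action on \<open>\<complex>[\<Lambda>] \<otimes> W\<close> of a map \<open>f\<close> of parity \<open>k\<close> that supercommutes with \<open>\<lambda>\<close> and \<open>\<chi>\<close>.\<close>

fun lift_spoly :: "bit \<Rightarrow> ('w::ab_group_add \<Rightarrow> 'x::ab_group_add) \<Rightarrow> 'w spoly \<Rightarrow> 'x spoly" where
  "lift_spoly k f (P0, P1) = (map_poly f P0, psign k (map_poly f P1))"

text \<open>The action of \<open>D\<close>, which does not supercommute with \<open>\<chi>\<close>: \<open>D \<chi> = 2 \<lambda> - \<chi> D\<close>.\<close>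

fun D_spoly :: "('w::ab_group_add \<Rightarrow> 'w) \<Rightarrow> 'w spoly \<Rightarrow> 'w spoly" where
  "D_spoly D (P0, P1) = (map_poly D P0 + pCons 0 (P1 + P1), - map_poly D P1)"

text \<open>Substitution of operators \<open>T\<close>, \<open>X\<close> for \<open>\<lambda>\<close>, \<open>\<chi>\<close>, applying \<open>f\<close> to the coefficients. If \<open>f\<close> is odd,
  moving it past \<open>\<chi>\<close> costs a sign, which must be included in \<open>X\<close>.\<close>

definition subst_Lambda ::
  "('w::ab_group_add \<Rightarrow> 'w) \<Rightarrow> ('w \<Rightarrow> 'w) \<Rightarrow> ('v::ab_group_add \<Rightarrow> 'w) \<Rightarrow> 'v spoly \<Rightarrow> 'w" where
  "subst_Lambda T X f P = subst_lambda T f (fst P) + X (subst_lambda T f (snd P))"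

text \<open>\<open>\<complex>[\<Lambda>, \<Gamma>] \<otimes> V\<close> is \<^typ>\<open>'v spoly spoly\<close> with outer variables \<open>\<Lambda> = (\<lambda>, \<chi>)\<close> and inner variables
  \<open>\<Gamma> = (\<gamma>, \<eta>)\<close>, so that \<open>\<chi> \<eta> = - \<eta> \<chi>\<close>.\<close>

abbreviation (input) sgam :: "'v::ab_group_add spoly spoly \<Rightarrow> 'v spoly spoly" where
  "sgam \<equiv> lift_spoly 0 times_lam"

abbreviation (input) seta :: "'v::ab_group_add spoly spoly \<Rightarrow> 'v spoly spoly" where
  "seta \<equiv> lift_spoly 1 times_chi"

abbreviation (input) sconst2 :: "'v::ab_group_add \<Rightarrow> 'v spoly spoly" where
  "sconst2 x \<equiv> spoly_const (spoly_const x)"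

text \<open>The left derivative \<open>\<partial>\<^sub>\<eta>\<close> (it is odd and anticommutes with \<open>\<chi>\<close>), followed by \<open>\<integral>\<^sub>0\<^sup>\<lambda> d\<gamma>\<close>; the two
  operations commute.\<close>

definition d_eta :: "'v::ab_group_add spoly spoly \<Rightarrow> 'v poly spoly" where
  "d_eta = lift_spoly 1 snd"

fun spint_lambda :: "(complex \<Rightarrow> 'v::ab_group_add \<Rightarrow> 'v) \<Rightarrow> 'v poly spoly \<Rightarrow> 'v spoly" where
  "spint_lambda s (Q0, Q1) = (pint_lambda s Q0, pint_lambda s Q1)"

text \<open>\<open>sbr a b\<close> is \<open>[a \<^sub>\<Lambda> b]\<close>. As the bracket is odd, \<open>[a \<^sub>\<Lambda> \<eta> x] = (-1)^(p(a)+1) \<eta> [a \<^sub>\<Lambda> x]\<close> and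
  \<open>[\<chi> x \<^sub>\<Gamma> c] = - \<chi> [x \<^sub>\<Gamma> c]\<close>; this is where the signs on the variables in the Jacobi identity come
  from.\<close>

locale n1_susy_vertex_algebra = unital_differential_superalgebra s gr d vac nop
  for s :: "complex \<Rightarrow> 'v::ab_group_add \<Rightarrow> 'v" and gr and d and vac and nop +
  fixes D :: "'v \<Rightarrow> 'v" and sbr :: "'v \<Rightarrow> 'v \<Rightarrow> 'v spoly"
  assumes D_odd_derivation: "odd_derivation s gr nop D"
    and D_square: "D (D a) = d a"
    and sbr_add_left: "sbr (a + a') b = sbr a b + sbr a' b"
    and sbr_add_right: "sbr a (b + b') = sbr a b + sbr a b'"
    and sbr_scale_left: "sbr (s k a) b = lift_spoly 0 (s k) (sbr a b)"
    and sbr_scale_right: "sbr a (s k b) = lift_spoly 0 (s k) (sbr a b)"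
    and sbr_odd: "a \<in> gr p \<Longrightarrow> b \<in> gr q \<Longrightarrow>
      coeff (fst (sbr a b)) m \<in> gr (p + q + 1) \<and> coeff (snd (sbr a b)) m \<in> gr (p + q)"
    and sbr_D_left: "sbr (D a) b = times_chi (sbr a b)"
    and sbr_D_right: "a \<in> gr p \<Longrightarrow>
      sbr a (D b) = psign (p + 1) (D_spoly D (sbr a b) + times_chi (sbr a b))"
    and sbr_skew: "a \<in> gr p \<Longrightarrow> b \<in> gr q \<Longrightarrow>
      sbr b a = psign (p * q)
        (subst_Lambda (\<lambda>P. - lift_spoly 0 d P - times_lam P) (\<lambda>P. - D_spoly D P - times_chi P)
          spoly_const (sbr a b))"
    and sbr_jacobi: "a \<in> gr p \<Longrightarrow> b \<in> gr q \<Longrightarrow>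
      subst_Lambda sgam (\<lambda>w. psign (p + 1) (seta w))
        (\<lambda>x. subst_Lambda times_lam times_chi sconst2 (sbr a x)) (sbr b c) =
      psign (p + 1)
        (subst_Lambda times_lam (\<lambda>w. - times_chi w)
          (\<lambda>x. subst_Lambda (\<lambda>w. times_lam w + sgam w) (\<lambda>w. times_chi w + seta w) sconst2
             (sbr x c)) (sbr a b)) +
      psign ((p + 1) * (q + 1))
        (subst_Lambda times_lam (\<lambda>w. psign (q + 1) (times_chi w))
          (\<lambda>x. subst_Lambda sgam seta sconst2 (sbr b x)) (sbr a c))"
    and susy_quasi_comm: "quasi_commutative s gr d (\<lambda>a b. snd (sbr a b)) nop"
    and susy_quasi_assoc: "quasi_associative s gr d (\<lambda>a b. snd (sbr a b)) nop"
    and susy_wick: "a \<in> gr p \<Longrightarrow> b \<in> gr q \<Longrightarrow>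
      sbr a (nop b c) =
      lift_spoly 0 (\<lambda>x. nop x c) (sbr a b) +
      psign ((p + 1) * q) (lift_spoly q (nop b) (sbr a c)) +
      spint_lambda s (d_eta (lift_spoly 1 (\<lambda>x. sbr x c) (sbr a b)))"

definition is_n1_susy_with ::
  "(complex \<Rightarrow> 'v::ab_group_add \<Rightarrow> 'v) \<Rightarrow> (bit \<Rightarrow> 'v set) \<Rightarrow> ('v \<Rightarrow> 'v) \<Rightarrow>
    ('v \<Rightarrow> 'v \<Rightarrow> 'v poly) \<Rightarrow> 'v \<Rightarrow> ('v \<Rightarrow> 'v \<Rightarrow> 'v) \<Rightarrow> ('v \<Rightarrow> 'v) \<Rightarrow> bool" where
  "is_n1_susy_with s gr d br vac nop D \<longleftrightarrow>
     vertex_algebra s gr d br vac nop \<and>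
     n1_susy_vertex_algebra s gr d vac nop D (\<lambda>a b. (br (D a) b, br a b))"

end

theory Submission
  imports Defs
begin

text \<open>By (SEF1) and (SEF2), \<open>D\<close> is an odd derivation of the \<open>\<lambda>\<close>-bracket on the generators and hence, by
  sesquilinearity, on the whole Lie conformal algebra \<open>L = R \<oplus> Rbar\<close>. Quasi-commutativity and quasi-associativity make \<open>V\<close> a representation
  of the Lie superalgebra \<open>(L, \<integral>\<^sub>-\<^sub>\<partial>\<^sup>0 [a \<^sub>\<lambda> b] d\<lambda>)\<close>, which by the PBW property is its enveloping algebra;
  thus \<open>D\<close> extends to a unique map on \<open>V\<close> satisfying the Leibniz rule for products \<open>:rx:\<close> with
  \<open>r \<in> L\<close>. Induction on the length of monomials, using the Wick formula, skew-symmetry and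
  quasi-associativity, extends the Leibniz rule to all products and all brackets. For an odd derivation
  of both operations with square \<open>\<partial>\<close>, the axioms for \<open>[a \<^sub>\<Lambda> b] = [Da \<^sub>\<lambda> b] + \<chi> [a \<^sub>\<lambda> b]\<close> follow by comparing the
  coefficients of \<open>1\<close>, \<open>\<chi>\<close>, \<open>\<eta>\<close> and \<open>\<chi> \<eta>\<close>.\<close>

section \<open>Polynomials with vector coefficients\<close>

text \<open>(SEF2) is the Leibniz rule for a pair x, y of generators, solved for
  \<open>[x \<^sub>\<lambda> Dy]\<close>; (SEF1) is the rule for Dx, y with D(Dx) = \<partial>x
  inserted. The first obstacle is that the extension of D can be prescribed freely only on sorted
  monomials, whereas multiplying by a generator produces unsorted ones. Instead of comparing V with
  a quotient of a tensor algebra, the proof lets generators act on pairs (x, y), with y in the role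
  of the derivative of x. Straightening works in any representation, hence also for pairs, and turns
  the Leibniz rule into the invariance of a subspace. The second obstacle is a circle: the rule for
  products (ab)c involves brackets with a and b, and the rule for a bracket with a product involves
  products and brackets formed with the coefficients of another bracket. Word length breaks it,
  because bracketing with a generator never lengthens a word. As the Wick formula opens products on
  the right only, the left argument is reached through skew-symmetry. The sign of the Leibniz rule
  is carried by the parity operator, so that the rule defines subspaces and can be checked on
  spanning sets.\<close>

lemma additive_plus:
  assumes "additive f" and "additive g" shows "additive (\<lambda>x. f x + g x)"
  using assms by (simp add: additive_def algebra_simps)

lemma additive_minus: "additive f \<Longrightarrow> additive (\<lambda>x. - f x)"
  by (simp add: additive_def)

lemma additive_comp: "additive f \<Longrightarrow> additive g \<Longrightarrow> additive (\<lambda>x. f (g x))"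
  by (simp add: additive_def)

lemma additive_id: "additive (\<lambda>x. x)"
  by (simp add: additive_def)

lemma additive_funpow:
  fixes T :: "'a::ab_group_add \<Rightarrow> 'a"
  shows "additive T \<Longrightarrow> additive (T ^^ n)"
  by (induction n) (simp_all add: additive_def)

lemma additive_psign: "additive (psign p)"
  by (simp add: additive_def psign_def)

lemma psign_apply:
  "additive f \<Longrightarrow> f (psign p x) = psign p (f x)"
  for f :: "'a::ab_group_add \<Rightarrow> 'b::ab_group_add"
  by (simp add: psign_def additive.minus)

lemma coeff_psign: "coeff (psign p P) n = psign p (coeff P n)"
  by (simp add: psign_def)

lemma additive_pCons_0: "additive (pCons 0)"
  by (simp add: additive_def)

lemma additive_const_poly: "additive (\<lambda>x. [:x:])"
  by (simp add: additive_def)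

lemma map_poly_add_poly:
  assumes "additive f" shows "map_poly f (P + Q) = map_poly f P + map_poly f Q"
  using assms by (intro poly_eqI) (simp add: coeff_map_poly additive.zero additive.add)

lemma additive_map_poly: "additive f \<Longrightarrow> additive (map_poly f)"
  by (simp add: additive_def map_poly_add_poly)

lemma map_poly_uminus:
  fixes f :: "'a::ab_group_add \<Rightarrow> 'b::ab_group_add"
  shows "additive f \<Longrightarrow> map_poly f (- P) = - map_poly f P"
  by (rule additive.minus[OF additive_map_poly])

lemma map_poly_psign:
  fixes f :: "'a::ab_group_add \<Rightarrow> 'b::ab_group_add"
  shows "additive f \<Longrightarrow> map_poly f (psign p P) = psign p (map_poly f P)"
  by (simp add: psign_def map_poly_uminus)

lemma map_poly_comp:
  assumes "f 0 = 0" "g 0 = 0"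
  shows "map_poly f (map_poly g P) = map_poly (\<lambda>x. f (g x)) P"
  using assms by (intro poly_eqI) (simp add: coeff_map_poly)

lemma map_poly_pCons_0: "f 0 = 0 \<Longrightarrow> map_poly f (pCons 0 P) = pCons 0 (map_poly f P)"
  by (intro poly_eqI) (simp add: coeff_map_poly coeff_pCons split: nat.split)

text \<open>Covers both the substitution of an operator for \<lambda> and the sums in
  quasi-associativity, whose terms are not powers of one operator. The bound \<open>degree P\<close>
  does not behave additively in \<open>P\<close>; \<open>psum_bound\<close> trades it for a common
  one.\<close>

definition psum :: "(nat \<Rightarrow> 'v::zero \<Rightarrow> 'w::comm_monoid_add) \<Rightarrow> 'v poly \<Rightarrow> 'w" where
  "psum g P = (\<Sum>j\<le>degree P. g j (coeff P j))"

lemma psum_bound: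
  assumes "\<And>j. g j 0 = 0" and "degree P \<le> N"
  shows "psum g P = (\<Sum>j\<le>N. g j (coeff P j))"
  unfolding psum_def using assms by (intro sum.mono_neutral_left) (auto simp: coeff_eq_0)

lemma psum_add:
  assumes "\<And>j. additive (g j)" shows "psum g (P + Q) = psum g P + psum g Q"
proof -
  define N where "N = max (degree P) (degree Q)"
  have z: "\<And>j. g j 0 = 0" by (rule additive.zero[OF assms])
  have "degree (P + Q) \<le> N" "degree P \<le> N" "degree Q \<le> N"
    by (simp_all add: N_def degree_add_le)
  then show ?thesis
    by (simp add: psum_bound[where N = N] z additive.add[OF assms] sum.distrib)
qed

lemma additive_psum: "(\<And>j. additive (g j)) \<Longrightarrow> additive (psum g)"
  by (simp add: additive_def psum_add[unfolded additive_def])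

lemma additive_apply_psum:
  assumes "additive h" shows "h (psum g P) = psum (\<lambda>j x. h (g j x)) P"
  unfolding psum_def by (rule additive.sum[OF assms])

lemma psum_map_poly:
  assumes "f 0 = 0" and "\<And>j. g j 0 = 0"
  shows "psum g (map_poly f P) = psum (\<lambda>j x. g j (f x)) P"
proof -
  have "degree (map_poly f P) \<le> degree P" by (rule map_poly_degree_leq)
  then show ?thesis
    using assms by (simp add: psum_bound[where N = "degree P"] coeff_map_poly)
qed

lemma psum_fun_add: "psum (\<lambda>j x. g j x + h j x) P = psum g P + psum h P"
  by (simp add: psum_def sum.distrib)

lemma psum_pCons_0:
  assumes "\<And>j. g j 0 = 0"
  shows "psum g (pCons 0 P) = psum (\<lambda>j. g (Suc j)) P"
proof -
  have "psum g (pCons 0 P) = (\<Sum>j\<le>Suc (degree P). g j (coeff (pCons 0 P) j))"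
    using assms by (intro psum_bound) (auto simp: degree_pCons_le)
  also have "\<dots> = (\<Sum>j\<le>degree P. g (Suc j) (coeff P j))"
    by (simp add: assms sum.atMost_Suc_shift del: sum.atMost_Suc)
  finally show ?thesis by (simp add: psum_def)
qed

lemma subst_lambda_psum: "subst_lambda T f P = psum (\<lambda>m x. (T ^^ m) (f x)) P"
  by (simp add: subst_lambda_def psum_def)

lemma additive_subst_lambda:
  assumes "additive T" "additive f" shows "additive (subst_lambda T f)"
  unfolding subst_lambda_psum[abs_def]
  by (rule additive_psum, rule additive_comp[OF additive_funpow[OF assms(1)] assms(2)])

text \<open>A map intertwining \<open>T\<close> and \<open>T'\<close> intertwines their powers. This
  is how D, \<iota>, the parity operator and the embedding of polynomials pass through integrals and
  substitutions.\<close>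

lemma subst_lambda_hom:
  assumes "additive h" and "\<And>x. h (T x) = T' (h x)"
  shows "h (subst_lambda T f P) = subst_lambda T' (\<lambda>x. h (f x)) P"
proof -
  have "h ((T ^^ m) x) = (T' ^^ m) (h x)" for m x
    by (induction m) (simp_all add: assms)
  then show ?thesis
    by (simp add: subst_lambda_psum additive_apply_psum[OF assms(1)])
qed

lemma subst_lambda_map_poly:
  assumes "additive T" "additive f" "g 0 = 0"
  shows "subst_lambda T f (map_poly g P) = subst_lambda T (\<lambda>x. f (g x)) P"
  unfolding subst_lambda_psum
  using assms by (intro psum_map_poly)
    (simp_all add: additive.zero[OF additive_funpow] additive.zero)

lemma subst_lambda_fun_add:
  assumes "additive T"
  shows "subst_lambda T (\<lambda>x. f x + g x) P = subst_lambda T f P + subst_lambda T g P"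
  by (simp add: subst_lambda_psum additive.add[OF additive_funpow[OF assms]] psum_fun_add)

lemma subst_lambda_pCons_0:
  assumes "additive T" "additive f"
  shows "subst_lambda T f (pCons 0 P) = T (subst_lambda T f P)"
proof -
  have "(T ^^ m) (f 0) = 0" for m
    using assms by (simp add: additive.zero[OF additive_funpow] additive.zero)
  then show ?thesis
    by (simp add: subst_lambda_psum psum_pCons_0 additive_apply_psum[OF assms(1)])
qed

section \<open>Formal integration of vector-valued polynomials\<close>

locale complex_vector_space = vector_space s
  for s :: "complex \<Rightarrow> 'v::ab_group_add \<Rightarrow> 'v"
begin

lemma coeff_pint:
  "coeff (pint s P) n = (if n = 0 then 0 else s (1 / of_nat n) (coeff P (n - 1)))"
proof -
  have eq: "\<And>j. (j + 1 = n) = (n \<noteq> 0 \<and> j = n - 1)" by auto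
  have "coeff (pint s P) n =
      (\<Sum>j\<le>degree P. if j + 1 = n then s (1 / of_nat (j + 1)) (coeff P j) else 0)"
    by (simp only: pint_def coeff_sum coeff_monom)
  also have "\<dots> = (if n = 0 then 0 else s (1 / of_nat n) (coeff P (n - 1)))"
    unfolding eq by (cases "n = 0") (auto simp: sum.delta coeff_eq_0)
  finally show ?thesis .
qed

lemma additive_pint: "additive (pint s)"
  by unfold_locales (intro poly_eqI, simp add: coeff_pint scale_right_distrib)

lemma additive_pint_lambda: "additive (pint_lambda s)"
  unfolding pint_lambda_def[abs_def]
  by (intro additive_subst_lambda additive_pCons_0 additive_pint)

lemma coeff_pint_mem:
  assumes "subspace X" "\<And>n. coeff P n \<in> X" shows "coeff (pint s P) n \<in> X"
  using assms by (auto simp: coeff_pint subspace_scale subspace_0)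

lemma coeff_pint_lambda_mem:
  assumes X: "subspace X" and Q: "\<And>n m. coeff (coeff Q n) m \<in> X"
  shows "coeff (pint_lambda s Q) n \<in> X"
proof -
  have "coeff ((pCons 0 ^^ k) (pint s (coeff Q m))) n \<in> X" for k m n
    by (induction k arbitrary: n)
      (use X Q in \<open>auto simp: coeff_pCons subspace_0 coeff_pint_mem split: nat.split\<close>)
  then show ?thesis
    by (auto simp: pint_lambda_def subst_lambda_def coeff_sum intro!: subspace_sum X)
qed

lemma additive_scale: "additive (s k)"
  by unfold_locales (rule scale_right_distrib)

lemma psign_mem: "subspace X \<Longrightarrow> x \<in> X \<Longrightarrow> psign p x \<in> X"
  by (simp add: psign_def subspace_neg)

lemma scale_psign: "s k (psign p x) = psign p (s k x)"
  by (simp add: psign_def)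

end

sublocale super_vector_space \<subseteq> complex_vector_space ..

lemma linear_additive: "Vector_Spaces.linear s s' f \<Longrightarrow> additive f"
  by unfold_locales (simp add: Vector_Spaces.linear_def module_hom_iff)

lemma linear_scale': "Vector_Spaces.linear s s' f \<Longrightarrow> f (s k x) = s' k (f x)"
  by (simp add: Vector_Spaces.linear_def module_hom_iff)

lemma linear_map_pint:
  assumes "Vector_Spaces.linear s s' f"
  shows "map_poly f (pint s P) = pint s' (map_poly f P)"
proof -
  interpret l: Vector_Spaces.linear s s' f by (rule assms)
  interpret A: complex_vector_space s ..
  interpret B: complex_vector_space s' ..
  show ?thesis
    by (intro poly_eqI) (simp add: A.coeff_pint B.coeff_pint coeff_map_poly l.scale)
qed

lemma linear_map_pint_lambda:
  assumes f: "Vector_Spaces.linear s s' f"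
  shows "map_poly f (pint_lambda s Q) = pint_lambda s' (map_poly (map_poly f) Q)"
proof -
  interpret l: Vector_Spaces.linear s s' f by (rule f)
  interpret B: complex_vector_space s' ..
  have "map_poly f (subst_lambda (pCons 0) (pint s) Q) =
      subst_lambda (pCons 0) (\<lambda>x. map_poly f (pint s x)) Q"
    by (rule subst_lambda_hom)
      (simp_all add: additive_map_poly linear_additive[OF f] map_poly_pCons_0)
  also have "\<dots> = subst_lambda (pCons 0) (pint s') (map_poly (map_poly f) Q)"
    by (simp add: subst_lambda_map_poly additive_pCons_0 B.additive_pint linear_map_pint[OF f])
  finally show ?thesis by (simp add: pint_lambda_def)
qed

text \<open>\<open>parity_op gr\<close> acts on homogeneous elements by the sign of their parity. It turns the sign rule
  of an odd derivation into identities that are linear in all arguments.\<close>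

definition parity_op :: "(bit \<Rightarrow> 'v::ab_group_add set) \<Rightarrow> 'v \<Rightarrow> 'v" where
  "parity_op gr x = (THE w. \<exists>y\<in>gr 0. \<exists>z\<in>gr 1. x = y + z \<and> w = y - z)"

context super_vector_space
begin

lemma parity_op_sum:
  assumes "y \<in> gr 0" "z \<in> gr 1" shows "parity_op gr (y + z) = y - z"
  unfolding parity_op_def
proof (rule the_equality)
  show "\<exists>y'\<in>gr 0. \<exists>z'\<in>gr 1. y + z = y' + z' \<and> y - z = y' - z'"
    using assms by blast
next
  fix w assume "\<exists>y'\<in>gr 0. \<exists>z'\<in>gr 1. y + z = y' + z' \<and> w = y' - z'"
  then obtain y' z' where *: "y' \<in> gr 0" "z' \<in> gr 1" "y + z = y' + z'" "w = y' - z'" by blast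
  then have eq: "y - y' = z' - z" by (simp add: algebra_simps)
  moreover have "y - y' \<in> gr 0" "z' - z \<in> gr 1"
    using * assms by (auto intro: subspace_diff gr_subspace)
  ultimately have "y - y' \<in> gr 0 \<inter> gr 1" by auto
  then have "y = y'" using gr_disjoint by simp
  with eq * show "w = y - z" by simp
qed

lemma zero_in_gr: "0 \<in> gr p"
  by (rule subspace_0[OF gr_subspace])

lemma parity_op_hom: "x \<in> gr p \<Longrightarrow> parity_op gr x = psign p x"
  using parity_op_sum[of x 0] parity_op_sum[of 0 x] zero_in_gr
  by (cases p) (simp_all add: psign_def)

lemma parity_op_parity_op: "parity_op gr (parity_op gr x) = x"
proof -
  obtain y z where yz: "y \<in> gr 0" "z \<in> gr 1" "x = y + z" using gr_decomp by blast
  then have "parity_op gr (y + - z) = y - - z"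
    by (intro parity_op_sum subspace_neg[OF gr_subspace])
  then show ?thesis using yz by (simp add: parity_op_sum)
qed

lemma parity_op_linear: "Vector_Spaces.linear s s (parity_op gr)"
proof -
  have "parity_op gr (a + b) = parity_op gr a + parity_op gr b" for a b
  proof -
    obtain y z y' z' where *: "y \<in> gr 0" "z \<in> gr 1" "a = y + z" "y' \<in> gr 0" "z' \<in> gr 1" "b = y' + z'"
      using gr_decomp[of a] gr_decomp[of b] by blast
    then have "a + b = (y + y') + (z + z')" by simp
    then have "parity_op gr (a + b) = (y + y') - (z + z')"
      using * by (auto simp only: intro!: parity_op_sum subspace_add[OF gr_subspace])
    then show ?thesis using * by (simp add: parity_op_sum)
  qed
  moreover have "parity_op gr (s k a) = s k (parity_op gr a)" for k a
  proof -
    obtain y z where *: "y \<in> gr 0" "z \<in> gr 1" "a = y + z"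
      using gr_decomp[of a] by blast
    then have "parity_op gr (s k y + s k z) = s k y - s k z"
      by (auto simp only: intro!: parity_op_sum subspace_scale[OF gr_subspace])
    then show ?thesis using * by (simp add: parity_op_sum scale_right_distrib scale_right_diff_distrib)
  qed
  ultimately show ?thesis
    using vector_space_axioms
    by (simp add: Vector_Spaces.linear_def module_hom_iff module_iff_vector_space)
qed

lemmas additive_parity_op = linear_additive[OF parity_op_linear]

lemma homogeneous_induct:
  assumes "subspace X" "\<And>p x. x \<in> gr p \<Longrightarrow> x \<in> X" shows "x \<in> X"
  using assms gr_decomp[of x] by (auto intro: subspace_add)

text \<open>The scaling \<open>h\<close> of the target is left open so that identities between
  brackets are covered as well, with \<open>h k = map_poly (s k)\<close>. Together with
  \<open>homogeneous_induct\<close> this reduces such identities to homogeneous arguments.\<close>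

lemma subspace_additive_eq:
  assumes f: "additive f" "additive g"
    and s: "\<And>k x. f (s k x) = h k (f x)" "\<And>k x. g (s k x) = h k (g x)"
  shows "subspace {x. f x = g x}"
  using f s by (auto simp: subspace_def additive.zero additive.add)

end

lemma parity_op_commute:
  assumes f: "linear_of_parity k s gr s' gr' f"
    and "super_vector_space s gr" "super_vector_space s' gr'"
  shows "f (parity_op gr x) = psign k (parity_op gr' (f x))"
proof -
  interpret A: super_vector_space s gr by fact
  interpret B: super_vector_space s' gr' by fact
  have fl: "Vector_Spaces.linear s s' f" and fp: "\<And>p x. x \<in> gr p \<Longrightarrow> f x \<in> gr' (p + k)"
    using f unfolding linear_of_parity_def by blast+
  note fa = linear_additive[OF fl]
  obtain y z where *: "y \<in> gr 0" "z \<in> gr 1" "x = y + z" using A.gr_decomp by blast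
  have "f (parity_op gr x) = f y - f z"
    using * by (simp add: A.parity_op_sum additive.diff[OF fa])
  moreover have "parity_op gr' (f x) = psign k (f y) + psign (1 + k) (f z)"
    using fp[of y 0] fp[of z 1] *
    by (simp add: additive.add[OF fa] additive.add[OF B.additive_parity_op] B.parity_op_hom)
  ultimately show ?thesis by (cases k) (simp_all add: psign_def)
qed

section \<open>Odd derivations of a Lie conformal algebra\<close>

context lie_conformal_algebra
begin

lemma d_lin: "Vector_Spaces.linear s s d"
  using d_even by (simp add: linear_of_parity_def)

lemmas additive_d = linear_additive[OF d_lin]

lemma d_gr: "x \<in> gr p \<Longrightarrow> d x \<in> gr p"
  using d_even unfolding linear_of_parity_def add_0_right by blast

lemma d_parity_op: "d (parity_op gr x) = parity_op gr (d x)"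
  using parity_op_commute[OF d_even super_vector_space_axioms super_vector_space_axioms, of x]
  by (simp add: psign_def)

lemma additive_br_left: "additive (\<lambda>a. br a b)"
  by unfold_locales (rule br_add_left)

lemma additive_br_right: "additive (br a)"
  by unfold_locales (rule br_add_right)

lemmas br_zero_left = additive.zero[OF additive_br_left]
  and br_zero_right = additive.zero[OF additive_br_right]
  and br_minus_left = additive.minus[OF additive_br_left]
  and br_minus_right = additive.minus[OF additive_br_right]

lemma br_psign_left: "br (psign p a) b = psign p (br a b)"
  by (simp add: psign_def br_minus_left)

lemma br_psign_right: "br a (psign p b) = psign p (br a b)"
  by (simp add: psign_def br_minus_right)

lemma br_parity_op: "map_poly (parity_op gr) (br a b) = br (parity_op gr a) (parity_op gr b)"
proof -
  let ?\<sigma> = "parity_op gr"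
  have hom: "map_poly ?\<sigma> (br a b) = br (?\<sigma> a) (?\<sigma> b)" if "a \<in> gr p" "b \<in> gr q" for a b p q
  proof (rule poly_eqI)
    fix n
    have "parity_op gr (coeff (br a b) n) = psign (p + q) (coeff (br a b) n)"
      by (rule parity_op_hom[OF br_parity[OF that]])
    then show "coeff (map_poly ?\<sigma> (br a b)) n = coeff (br (?\<sigma> a) (?\<sigma> b)) n"
      unfolding parity_op_hom[OF that(1)] parity_op_hom[OF that(2)] br_psign_left br_psign_right
      by (cases p; cases q)
        (simp_all add: coeff_map_poly additive.zero[OF additive_parity_op] psign_def)
  qed
  have sub1: "subspace {a. map_poly ?\<sigma> (br a b) = br (?\<sigma> a) (?\<sigma> b)}" for b
    by (rule subspace_additive_eq[where h = "\<lambda>k. map_poly (s k)",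
          OF additive_comp[OF additive_map_poly[OF additive_parity_op] additive_br_left]
            additive_comp[OF additive_br_left additive_parity_op]])
      (simp_all add: br_scale_left linear_scale'[OF parity_op_linear] map_poly_comp
        additive.zero[OF additive_parity_op])
  have sub2: "subspace {b. map_poly ?\<sigma> (br a b) = br (?\<sigma> a) (?\<sigma> b)}" for a
    by (rule subspace_additive_eq[where h = "\<lambda>k. map_poly (s k)",
          OF additive_comp[OF additive_map_poly[OF additive_parity_op] additive_br_right]
            additive_comp[OF additive_br_right additive_parity_op]])
      (simp_all add: br_scale_right linear_scale'[OF parity_op_linear] map_poly_comp
        additive.zero[OF additive_parity_op])
  have "b \<in> {b. map_poly ?\<sigma> (br a b) = br (?\<sigma> a) (?\<sigma> b)}" if "a \<in> gr p" for a b p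
    by (rule homogeneous_induct[OF sub2]) (simp add: hom[OF that])
  then have "a \<in> {a. map_poly ?\<sigma> (br a b) = br (?\<sigma> a) (?\<sigma> b)}"
    by - (rule homogeneous_induct[OF sub1], simp)
  then show ?thesis by simp
qed

end

section \<open>Odd operators with square \<partial> and the Leibniz rule for the bracket\<close>

locale odd_operator = lie_conformal_algebra s gr d br
  for s :: "complex \<Rightarrow> 'v::ab_group_add \<Rightarrow> 'v" and gr d br +
  fixes D :: "'v \<Rightarrow> 'v"
  assumes D_odd: "linear_of_parity 1 s gr s gr D"
    and D_square: "D (D x) = d x"
begin

lemma D_lin: "Vector_Spaces.linear s s D"
  using D_odd by (simp add: linear_of_parity_def)

lemmas additive_D = linear_additive[OF D_lin]
  and D_zero [simp] = additive.zero[OF linear_additive[OF D_lin]]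

lemma D_gr: "x \<in> gr p \<Longrightarrow> D x \<in> gr (p + 1)"
  using D_odd unfolding linear_of_parity_def by blast

lemma D_parity_op: "D (parity_op gr x) = - parity_op gr (D x)"
  using parity_op_commute[OF D_odd super_vector_space_axioms super_vector_space_axioms, of x]
  by (simp add: psign_def)

lemma D_d: "D (d x) = d (D x)"
  by (simp flip: D_square)

definition leibniz :: "'v \<Rightarrow> 'v \<Rightarrow> bool" where
  "leibniz a b \<longleftrightarrow> map_poly D (br a b) = br (D a) b + br (parity_op gr a) (D b)"

lemma leibniz_hom:
  "a \<in> gr p \<Longrightarrow> leibniz a b \<longleftrightarrow> map_poly D (br a b) = br (D a) b + psign p (br a (D b))"
  by (simp add: leibniz_def parity_op_hom br_psign_left)

lemma subspace_leibniz_left: "subspace {a. leibniz a b}"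
  unfolding leibniz_def
  by (rule subspace_additive_eq[where h = "\<lambda>k. map_poly (s k)",
        OF additive_comp[OF additive_map_poly[OF additive_D] additive_br_left]
          additive_plus[OF additive_comp[OF additive_br_left additive_D]
            additive_comp[OF additive_br_left additive_parity_op]]])
    (simp add: br_scale_left map_poly_comp linear_scale'[OF D_lin],
      simp add: br_scale_left linear_scale'[OF D_lin] linear_scale'[OF parity_op_linear]
        map_poly_add_poly additive_scale)

lemma subspace_leibniz_right: "subspace {b. leibniz a b}"
  unfolding leibniz_def
  by (rule subspace_additive_eq[where h = "\<lambda>k. map_poly (s k)",
        OF additive_comp[OF additive_map_poly[OF additive_D] additive_br_right]
          additive_plus[OF additive_br_right additive_comp[OF additive_br_right additive_D]]])
    (simp add: br_scale_right map_poly_comp linear_scale'[OF D_lin],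
      simp add: br_scale_right linear_scale'[OF D_lin] map_poly_add_poly additive_scale)

lemma leibniz_d_left: "leibniz a b \<Longrightarrow> leibniz (d a) b"
  by (simp add: leibniz_def br_d_left map_poly_uminus[OF additive_D] map_poly_pCons_0 D_d
      flip: d_parity_op)

lemma map_poly_D_d: "map_poly D (map_poly d P) = map_poly d (map_poly D P)"
  by (simp add: map_poly_comp additive.zero[OF additive_d] D_d)

lemma leibniz_d_right: "leibniz a b \<Longrightarrow> leibniz a (d b)"
  by (simp add: leibniz_def br_d_right map_poly_add_poly[OF additive_D] map_poly_pCons_0 D_d
      map_poly_D_d map_poly_add_poly[OF additive_d])

text \<open>The pair x, y is (SEF2) and the pair Dx, y is (SEF1). For x, Dy and Dx, Dy, apply D to
  the two formulas: D(Dz) = \<partial>z and sesquilinearity express the result through brackets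
  whose other occurrences are again given by the formulas.\<close>

lemma leibniz_generator:
  assumes "supersymmetric_generator gr br D S" "x \<in> S" "y \<in> S"
  shows "leibniz x y" "leibniz x (D y)" "leibniz (D x) y" "leibniz (D x) (D y)"
proof -
  obtain p where p: "x \<in> gr p"
    using assms unfolding supersymmetric_generator_def by blast
  have 1: "br (D x) (D y) = psign (p + 1) (map_poly D (br (D x) y) + pCons 0 (br x y))"
    and 2: "br x (D y) = psign (p + 1) (br (D x) y - map_poly D (br x y))"
    using assms p unfolding supersymmetric_generator_def by blast+
  note hom = leibniz_hom[OF p] leibniz_hom[OF D_gr[OF p]]
  note simps = map_poly_psign[OF additive_D] map_poly_uminus[OF additive_D] map_poly_add_poly[OF additive_D]
    additive.diff[OF additive_map_poly[OF additive_D]] map_poly_pCons_0 map_poly_comp D_square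
    br_d_left br_d_right
  show "leibniz x y"
    unfolding hom 2 by (cases p) (simp_all add: psign_def)
  show "leibniz (D x) y"
    unfolding hom 1 by (cases p) (simp_all add: psign_def simps)
  show "leibniz x (D y)"
    unfolding hom 1 2 by (cases p) (simp_all add: psign_def simps)
  show "leibniz (D x) (D y)"
    unfolding hom 1 by (cases p) (simp_all add: psign_def simps 2)
qed

text \<open>Only brackets with the central element on the left are assumed to vanish. Skew-symmetry
  moves it to the right, but holds for homogeneous elements; gradedness of \<open>C\<close> keeps
  the homogeneous components central.\<close>

lemma leibniz_central:
  assumes C: "graded_subspace s gr C" and c: "c \<in> C"
    and br: "\<And>c x. c \<in> C \<Longrightarrow> br c x = 0" and "D c = 0"
  shows "leibniz c x" "leibniz x c"
proof -
  have sub: "subspace C" and dec: "\<And>c. c \<in> C \<Longrightarrow> \<exists>y\<in>C \<inter> gr 0. \<exists>z\<in>C \<inter> gr 1. c = y + z"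
    using C by (auto simp: graded_subspace_def)
  obtain y z where yz: "y \<in> C" "y \<in> gr 0" "z \<in> C" "z \<in> gr 1" "c = y + z"
    using dec[OF c] by blast
  then have "parity_op gr c \<in> C" by (simp add: parity_op_sum subspace_diff[OF sub])
  then show "leibniz c x" using assms by (simp add: leibniz_def br_zero_left)
  have hom: "br x w = 0" if w: "w \<in> C" "w \<in> gr p" for w p x
  proof -
    have "subspace {x. br x w = 0}"
      using additive_br_left[of w]
      by (auto simp: subspace_def additive.zero br_add_left br_scale_left br_zero_left)
    moreover have "br x w = 0" if "x \<in> gr q" for x q
      using br_skew[OF w(2) that] br[OF w(1)] by (simp add: subst_lambda_def psign_def)
    ultimately show ?thesis using homogeneous_induct[of "{x. br x w = 0}" x] by blast
  qed
  have "br x c = 0" for x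
    using yz hom by (simp add: br_add_right)
  then show "leibniz x c" using assms by (simp add: leibniz_def br_zero_right)
qed

end

section \<open>Straightening monomials\<close>

text \<open>The hypothesis \<open>action\<close> says that \<open>M\<close> is a representation of a Lie superalgebra with bracket \<open>w\<close>;
  the axioms of the bracket itself play no role for straightening monomials.\<close>

locale super_lie_action = super_vector_space s gr + M: vector_space sM
  for s :: "complex \<Rightarrow> 'r::ab_group_add \<Rightarrow> 'r" and gr
    and sM :: "complex \<Rightarrow> 'm::ab_group_add \<Rightarrow> 'm" +
  fixes \<rho> :: "'r \<Rightarrow> 'm \<Rightarrow> 'm" and w :: "'r \<Rightarrow> 'r \<Rightarrow> 'r" and m0 :: 'm
    and B :: "'r set" and r :: "('r \<times> 'r) set"
  assumes rho_lin_left: "Vector_Spaces.linear s sM (\<lambda>a. \<rho> a m)"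
    and rho_lin_right: "Vector_Spaces.linear sM sM (\<rho> a)"
    and action: "a \<in> gr p \<Longrightarrow> b \<in> gr q \<Longrightarrow>
      \<rho> a (\<rho> b m) = psign (p * q) (\<rho> b (\<rho> a m)) + \<rho> (w a b) m"
    and B_hom: "B \<subseteq> gr 0 \<union> gr 1"
    and B_span: "span B = UNIV"
    and B_order: "linear_order_on B r"
begin

text \<open>The letters are restricted only in the top length n + 1. In particular
  \<open>monomials n {}\<close> is the plain filtration by length at most n.\<close>

definition monomials :: "nat \<Rightarrow> 'r set \<Rightarrow> 'm set" where
  "monomials n A = M.span ((\<lambda>xs. foldr \<rho> xs m0) `
    {xs \<in> pbw_lists gr B r. length xs \<le> n \<or> length xs \<le> Suc n \<and> set xs \<subseteq> A})"

lemma monomials_base: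
  "xs \<in> pbw_lists gr B r \<Longrightarrow> length xs \<le> n \<or> length xs \<le> Suc n \<and> set xs \<subseteq> A \<Longrightarrow>
    foldr \<rho> xs m0 \<in> monomials n A"
  unfolding monomials_def by (intro M.span_base imageI) simp

lemma monomials_induct:
  assumes "x \<in> monomials n A" and "M.subspace X"
    and "\<And>xs. xs \<in> pbw_lists gr B r \<Longrightarrow> length xs \<le> n \<or> length xs \<le> Suc n \<and> set xs \<subseteq> A \<Longrightarrow>
      foldr \<rho> xs m0 \<in> X"
  shows "x \<in> X"
proof -
  have "monomials n A \<subseteq> X"
    unfolding monomials_def by (rule M.span_minimal[OF _ assms(2)]) (auto intro: assms(3))
  then show ?thesis using assms(1) by blast
qed

lemma subspace_monomials: "M.subspace (monomials n A)"
  by (simp add: monomials_def)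

lemma monomials_mono: "n < k \<Longrightarrow> monomials n A \<subseteq> monomials k A'"
  by (rule subsetI, erule monomials_induct[OF _ subspace_monomials], rule monomials_base) auto

lemma rho_monomials_all:
  assumes "\<And>a. a \<in> B \<Longrightarrow> \<rho> a x \<in> X" "M.subspace X" shows "\<rho> y x \<in> X"
proof -
  interpret l: Vector_Spaces.linear s sM "\<lambda>a. \<rho> a x" by (rule rho_lin_left)
  have "subspace {y. \<rho> y x \<in> X}"
    using assms(2) by (simp add: subspace_def M.subspace_def l.add l.scale l.zero)
  then show ?thesis
    using span_minimal[of B "{y. \<rho> y x \<in> X}"] assms(1) B_span by blast
qed

lemma subspace_rho_vimage: "M.subspace X \<Longrightarrow> M.subspace {x. \<rho> y x \<in> X}"
proof -
  interpret l: Vector_Spaces.linear sM sM "\<rho> y" by (rule rho_lin_right)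
  show "M.subspace X \<Longrightarrow> M.subspace {x. \<rho> y x \<in> X}"
    by (simp add: M.subspace_def l.add l.scale l.zero)
qed

text \<open>Keeping track of the letters of the leading term is what makes the induction on the length work:
  prepending \<open>b\<close> to it yields a monomial that is again sorted.\<close>

lemma straighten_length:
  assumes "bs \<in> pbw_lists gr B r" "length bs = n" "a \<in> B"
  shows "\<rho> a (foldr \<rho> bs m0) \<in> monomials n (insert a (set bs))"
  using assms
proof (induction n arbitrary: a bs rule: less_induct)
  case (less n)
  let ?pbw = "pbw_lists gr B r" and ?mon = "\<lambda>xs. foldr \<rho> xs m0"
  have r: "refl_on B r" "trans r" "antisym r" "total_on B r"
    using B_order by (simp_all add: order_on_defs)
  note r_refl = refl_onD[OF r(1)] and trans = transD[OF r(2)] and antisym = antisymD[OF r(3)]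
  have total: "(b, c) \<in> r \<or> (c, b) \<in> r" if "b \<in> B" "c \<in> B" for b c
    using that r(4) r_refl[of b] by (cases "b = c") (simp_all add: total_on_def)
  \<comment> \<open>On monomials of length k < n the result has length at most k + 1 \<le> n, where
    letters are unrestricted; so \<open>A\<close> and the acting element \<open>y\<close> are
    arbitrary here.\<close>
  have IH: "\<rho> y x \<in> monomials n A" if "x \<in> monomials k {}" "k < n" for y x k A
  proof (rule rho_monomials_all[OF _ subspace_monomials])
    fix b assume b: "b \<in> B"
    have "x \<in> {x. \<rho> b x \<in> monomials n A}"
      using that(1)
    proof (rule monomials_induct[OF _ subspace_rho_vimage[OF subspace_monomials]])
      fix xs assume xs: "xs \<in> ?pbw" "length xs \<le> k \<or> length xs \<le> Suc k \<and> set xs \<subseteq> {}"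
      then have "length xs < n" using that(2) by auto
      then show "?mon xs \<in> {x. \<rho> b x \<in> monomials n A}"
        using less.IH[OF _ xs(1) refl b] monomials_mono by blast
    qed
    then show "\<rho> b x \<in> monomials n A" by simp
  qed
  show ?case
  proof (cases bs)
    case Nil
    have "[a] \<in> ?pbw" using less.prems by (simp add: pbw_lists_def)
    from monomials_base[OF this, of n "{a}"] show ?thesis using Nil by simp
  next
    case (Cons b cs)
    then obtain k where k: "n = Suc k" "length cs = k" using less.prems by auto
    have b: "b \<in> B" and cs: "cs \<in> ?pbw" and
      bcs: "\<And>y. y \<in> set cs \<Longrightarrow> (b, y) \<in> r \<and> (b \<in> gr 1 \<longrightarrow> b \<noteq> y)"
      using less.prems(1) Cons by (auto simp: pbw_lists_def)
    have csk: "?mon cs \<in> monomials k {}"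
      by (rule monomials_base[OF cs]) (simp add: k)
    obtain p q where p: "a \<in> gr p" and q: "b \<in> gr q" using b less.prems B_hom by blast
    note ab = action[OF p q, of "?mon cs"]
    consider (le) "(a, b) \<in> r" "a \<in> gr 1 \<longrightarrow> a \<noteq> b" | (eq) "a = b" "a \<in> gr 1" | (gt) "(b, a) \<in> r" "a \<noteq> b"
      using total[OF b less.prems(3)] by blast
    then show ?thesis
    proof cases
      case le
      have "(a, y) \<in> r \<and> (a \<in> gr 1 \<longrightarrow> a \<noteq> y)" if "y \<in> set cs" for y
        using le bcs[OF that] trans antisym by blast
      then have "a # bs \<in> ?pbw"
        using le less.prems Cons by (auto simp: pbw_lists_def)
      from monomials_base[OF this, of n "insert a (set bs)"] show ?thesis
        using less.prems(2) by auto
    next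
      case eq
      \<comment> \<open>For an odd letter the commutation rule with itself reads 2 a(ax) = w(a,a)x,
        so a repeated odd letter is traded for a shorter expression.\<close>
      have "\<rho> a (\<rho> a (?mon cs)) = - \<rho> a (\<rho> a (?mon cs)) + \<rho> (w a a) (?mon cs)"
        using action[OF eq(2) eq(2), of "?mon cs"] by (simp add: psign_def)
      then have "\<rho> (w a a) (?mon cs) = sM 2 (\<rho> a (\<rho> a (?mon cs)))"
        using M.scale_left_distrib[of 1 1 "\<rho> a (\<rho> a (?mon cs))"] by (simp add: eq_diff_eq)
      then have "\<rho> a (\<rho> a (?mon cs)) = sM (1 / 2) (\<rho> (w a a) (?mon cs))" by simp
      also have "\<dots> \<in> monomials n (insert a (set bs))"
        using IH[OF csk] k by (intro M.subspace_scale subspace_monomials) simp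
      finally show ?thesis using Cons eq by simp
    next
      case gt
      have "?mon cs \<in> {x. \<rho> a x \<in> monomials k (insert a (set cs))}"
        using less.IH[OF _ cs k(2) less.prems(3)] k by simp
      then have "\<rho> a (?mon cs) \<in> monomials k (insert a (set cs))" by simp
      then have "\<rho> a (?mon cs) \<in> {x. \<rho> b x \<in> monomials n (insert a (set bs))}"
      proof (rule monomials_induct[OF _ subspace_rho_vimage[OF subspace_monomials]])
        fix xs
        assume xs: "xs \<in> ?pbw"
          "length xs \<le> k \<or> length xs \<le> Suc k \<and> set xs \<subseteq> insert a (set cs)"
        show "?mon xs \<in> {x. \<rho> b x \<in> monomials n (insert a (set bs))}"
        proof (cases "length xs \<le> k")
          case True
          then have "?mon xs \<in> monomials k {}" by (intro monomials_base xs) simp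
          from IH[OF this] k show ?thesis by simp
        next
          case False
          then have sub: "set xs \<subseteq> insert a (set cs)" and len: "length xs \<le> Suc k" using xs by auto
          have "(b, y) \<in> r \<and> (b \<in> gr 1 \<longrightarrow> b \<noteq> y)" if "y \<in> set xs" for y
            using that sub bcs gt by blast
          then have "b # xs \<in> ?pbw"
            using xs(1) b by (auto simp: pbw_lists_def)
          from monomials_base[OF this, of n "insert a (set bs)"] show ?thesis
            using len k sub Cons by auto
        qed
      qed
      then have "psign (p * q) (\<rho> b (\<rho> a (?mon cs))) \<in> monomials n (insert a (set bs))"
        by (simp add: psign_def M.subspace_neg[OF subspace_monomials])
      moreover have "\<rho> (w a b) (?mon cs) \<in> monomials n (insert a (set bs))"
        using IH[OF csk] k by simp
      ultimately show ?thesis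
        using ab Cons by (simp add: M.subspace_add[OF subspace_monomials])
    qed
  qed
qed

theorem pbw_span_invariant:
  assumes "x \<in> M.span ((\<lambda>xs. foldr \<rho> xs m0) ` pbw_lists gr B r)"
  shows "\<rho> a x \<in> M.span ((\<lambda>xs. foldr \<rho> xs m0) ` pbw_lists gr B r)"
proof -
  let ?K = "M.span ((\<lambda>xs. foldr \<rho> xs m0) ` pbw_lists gr B r)"
  have "monomials n A \<subseteq> ?K" for n A
    unfolding monomials_def by (intro M.span_mono) auto
  then have *: "\<rho> b (foldr \<rho> xs m0) \<in> ?K" if "xs \<in> pbw_lists gr B r" "b \<in> B" for b xs
    using straighten_length[OF that(1) refl that(2)] by blast
  have "\<rho> a (foldr \<rho> xs m0) \<in> ?K" if "xs \<in> pbw_lists gr B r" for xs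
    by (rule rho_monomials_all[OF *[OF that] M.subspace_span])
  then have "(\<lambda>xs. foldr \<rho> xs m0) ` pbw_lists gr B r \<subseteq> {x. \<rho> a x \<in> ?K}" by blast
  then show ?thesis
    using M.span_minimal[OF _ subspace_rho_vimage[OF M.subspace_span]] assms by blast
qed

end

section \<open>Odd operators on a vertex algebra\<close>

context unital_differential_superalgebra
begin

lemma additive_nop_left: "additive (\<lambda>a. nop a b)"
  by unfold_locales (rule nop_add_left)

lemma additive_nop_right: "additive (nop a)"
  by unfold_locales (rule nop_add_right)

lemmas nop_zero_left = additive.zero[OF additive_nop_left]
  and nop_zero_right = additive.zero[OF additive_nop_right]
  and nop_minus_left = additive.minus[OF additive_nop_left]
  and nop_minus_right = additive.minus[OF additive_nop_right]
  and nop_diff_left = additive.diff[OF additive_nop_left]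
  and nop_diff_right = additive.diff[OF additive_nop_right]

lemma nop_psign_left: "nop (psign p a) b = psign p (nop a b)"
  by (simp add: psign_def nop_minus_left)

lemma nop_psign_right: "nop a (psign p b) = psign p (nop a b)"
  by (simp add: psign_def nop_minus_right)

lemma nop_parity_op: "parity_op gr (nop a b) = nop (parity_op gr a) (parity_op gr b)"
proof -
  have sum: "parity_op gr (nop a b) = nop (parity_op gr a) (parity_op gr b)"
    if "a \<in> gr p" "b \<in> gr q" for a b p q
    unfolding parity_op_hom[OF nop_parity[OF that]] parity_op_hom[OF that(1)] parity_op_hom[OF that(2)]
    by (cases p; cases q) (simp_all add: psign_def nop_minus_left nop_minus_right)
  obtain a0 a1 where a: "a0 \<in> gr 0" "a1 \<in> gr 1" "a = a0 + a1" using gr_decomp by blast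
  obtain b0 b1 where b: "b0 \<in> gr 0" "b1 \<in> gr 1" "b = b0 + b1" using gr_decomp by blast
  show ?thesis
    unfolding a(3) b(3) nop_add_left nop_add_right additive.add[OF additive_parity_op]
    by (simp add: sum[OF a(1) b(1)] sum[OF a(1) b(2)] sum[OF a(2) b(1)] sum[OF a(2) b(2)])
qed

lemma d_vac: "d vac = 0"
  using d_derivation[of vac vac] by (simp add: vac_left vac_right)

end

text \<open>\<open>\<integral>\<^sub>-\<^sub>\<partial>\<^sup>0 P(\<lambda>) d\<lambda>\<close>\<close>

definition int_neg_d :: "(complex \<Rightarrow> 'v::ab_group_add \<Rightarrow> 'v) \<Rightarrow> ('v \<Rightarrow> 'v) \<Rightarrow> 'v poly \<Rightarrow> 'v" where
  "int_neg_d s d P = - subst_lambda (\<lambda>x. - d x) (\<lambda>x. x) (pint s P)"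

lemma int_neg_d_hom:
  assumes f: "Vector_Spaces.linear s s' f" and "\<And>x. f (d x) = d' (f x)"
    and d': "additive d'"
  shows "f (int_neg_d s d P) = int_neg_d s' d' (map_poly f P)"
proof -
  note fa = linear_additive[OF f]
  have "f (subst_lambda (\<lambda>x. - d x) (\<lambda>x. x) (pint s P)) = subst_lambda (\<lambda>x. - d' x) f (pint s P)"
    by (rule subst_lambda_hom[OF fa]) (simp add: additive.minus[OF fa] assms)
  also have "\<dots> = subst_lambda (\<lambda>x. - d' x) (\<lambda>x. x) (map_poly f (pint s P))"
    by (subst subst_lambda_map_poly[OF additive_minus[OF d'] additive_id])
      (simp_all add: additive.zero[OF fa])
  finally show ?thesis by (simp add: int_neg_d_def additive.minus[OF fa] linear_map_pint[OF f])
qed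

context lie_conformal_algebra
begin

lemma additive_int_neg_d: "additive (int_neg_d s d)"
  unfolding int_neg_d_def[abs_def]
  by (rule additive_minus, rule additive_comp[OF additive_subst_lambda[OF additive_minus[OF additive_d]
    additive_id] additive_pint])

definition skew_subst :: "'v poly \<Rightarrow> 'v poly" where
  "skew_subst = subst_lambda (\<lambda>P. - map_poly d P - pCons 0 P) (\<lambda>x. [:x:])"

lemma br_skew': "a \<in> gr p \<Longrightarrow> b \<in> gr q \<Longrightarrow> br b a = psign (p * q + 1) (skew_subst (br a b))"
  unfolding skew_subst_def by (rule br_skew)

lemma additive_skew_op: "additive (\<lambda>P. - map_poly d P - pCons 0 P)"
  using additive_plus[OF additive_minus[OF additive_map_poly[OF additive_d]]
    additive_minus[OF additive_pCons_0]] by (simp only: add_uminus_conv_diff)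

lemma additive_skew_subst: "additive skew_subst"
  unfolding skew_subst_def by (rule additive_subst_lambda[OF additive_skew_op additive_const_poly])

lemma coeff_skew_subst_mem:
  assumes X: "subspace X" "\<And>x. x \<in> X \<Longrightarrow> d x \<in> X" and P: "\<And>n. coeff P n \<in> X"
  shows "coeff (skew_subst P) n \<in> X"
proof -
  have "coeff (((\<lambda>P. - map_poly d P - pCons 0 P) ^^ k) [:coeff P m:]) n \<in> X" for k m n
    by (induction k arbitrary: n)
      (use X P in \<open>auto simp: coeff_pCons coeff_map_poly additive.zero[OF additive_d]
        subspace_0 subspace_diff subspace_neg split: nat.split\<close>)
  then show ?thesis
    by (auto simp: skew_subst_def subst_lambda_def coeff_sum intro!: subspace_sum X(1))
qed

end

lemma (in odd_operator) skew_subst_D: "map_poly D (skew_subst P) = skew_subst (map_poly D P)"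
proof -
  note mD = additive_map_poly[OF additive_D]
  have "map_poly D (skew_subst P) =
      subst_lambda (\<lambda>P. - map_poly d P - pCons 0 P) (\<lambda>x. map_poly D [:x:]) P"
    unfolding skew_subst_def
    by (rule subst_lambda_hom[OF mD])
      (simp add: additive.diff[OF mD] additive.minus[OF mD] map_poly_D_d map_poly_pCons_0)
  also have "\<dots> = skew_subst (map_poly D P)"
    unfolding skew_subst_def
    by (simp add: subst_lambda_map_poly[OF additive_skew_op additive_const_poly] map_poly_pCons)
  finally show ?thesis .
qed

text \<open>D commutes with \<partial>, hence with the substitution of -\<partial> - \<lambda> for
  \<lambda>, so the rule can be pushed through skew-symmetry.\<close>

lemma (in odd_operator) leibniz_skew:
  assumes a: "a \<in> gr p" and b: "b \<in> gr q" and "leibniz a b" shows "leibniz b a"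
proof -
  have "map_poly D (br a b) = br (D a) b + psign p (br a (D b))"
    using assms leibniz_hom by blast
  then have "map_poly D (br b a) = psign (p * q + 1)
      (skew_subst (br (D a) b) + psign p (skew_subst (br a (D b))))"
    unfolding br_skew'[OF a b] map_poly_psign[OF additive_D] skew_subst_D
    by (simp add: additive.add[OF additive_skew_subst] additive.minus[OF additive_skew_subst] psign_def)
  then show ?thesis
    unfolding leibniz_hom[OF b] br_skew'[OF D_gr[OF a] b] br_skew'[OF a D_gr[OF b]]
    by (cases p; cases q) (simp_all add: psign_def)
qed

section \<open>Consequences of the vertex algebra axioms\<close>

context vertex_algebra
begin

text \<open>As \<partial>|0> = 0, sesquilinearity gives (\<partial> +
  \<lambda>)\<open>[a \<^sub>\<lambda> |0>]\<close> = 0. But \<partial> + \<lambda> raises the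
  degree by one and keeps the leading coefficient.\<close>

lemma br_vac_right: "br a vac = 0"
proof (rule ccontr)
  assume nz: "br a vac \<noteq> 0"
  have "map_poly d (br a vac) + pCons 0 (br a vac) = 0"
    using br_d_right[of a vac] by (simp add: d_vac br_zero_right)
  then have "coeff (map_poly d (br a vac) + pCons 0 (br a vac)) (Suc (degree (br a vac))) = 0" by simp
  then have "coeff (br a vac) (degree (br a vac)) = 0"
    by (simp add: coeff_map_poly additive.zero[OF additive_d] coeff_eq_0)
  with nz show False by simp
qed

text \<open>One of the two sums in quasi-associativity: index j + 1 of \<open>neg_prod\<close> is
  the product a_(-j-2), and \<open>fact j\<close> recovers b_(j)c from the coefficient. Taking the
  whole polynomial as argument makes the sum additive in it.\<close>

definition assoc_term :: "'v \<Rightarrow> 'v poly \<Rightarrow> 'v" where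
  "assoc_term a = psum (\<lambda>j x. neg_prod s d nop (j + 1) a (s (fact j) x))"

lemma nop_nop:
  assumes "a \<in> gr p" "b \<in> gr q"
  shows "nop (nop a b) c =
    nop a (nop b c) + assoc_term a (br b c) + psign (p * q) (assoc_term b (br a c))"
proof -
  have "nop (nop a b) c - nop a (nop b c) =
      assoc_term a (br b c) + psign (p * q) (assoc_term b (br a c))"
    using quasi_assoc assms unfolding quasi_associative_def assoc_term_def psum_def nth_prod_def
    by blast
  then show ?thesis by (simp add: algebra_simps)
qed

text \<open>The quasi-associativity correction of (ab)c is supersymmetric in a and b, so it cancels
  in (ab)c minus the signed (ba)c; quasi-commutativity evaluates this difference.\<close>

lemma nop_left_commute:
  assumes a: "a \<in> gr p" and b: "b \<in> gr q"
  shows "nop a (nop b c) = psign (p * q) (nop b (nop a c)) + nop (int_neg_d s d (br a b)) c"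
proof -
  have "nop a b - psign (p * q) (nop b a) = int_neg_d s d (br a b)"
    using quasi_comm a b unfolding quasi_commutative_def int_neg_d_def by blast
  then have "nop (int_neg_d s d (br a b)) c =
      nop (nop a b) c - psign (p * q) (nop (nop b a) c)"
    by (metis nop_diff_left nop_psign_left)
  also have "\<dots> = nop a (nop b c) - psign (p * q) (nop b (nop a c))"
    unfolding nop_nop[OF a b] nop_nop[OF b a]
    by (cases p; cases q) (simp_all add: psign_def)
  finally show ?thesis by simp
qed

lemma additive_neg_prod_term: "additive (\<lambda>x. neg_prod s d nop (j + 1) a (s (fact j) x))"
  by unfold_locales (simp add: neg_prod_def nop_add_right scale_right_distrib)

lemma additive_assoc_term: "additive (assoc_term a)"
  unfolding assoc_term_def by (rule additive_psum[OF additive_neg_prod_term])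

end

locale vertex_odd_operator =
  vertex_algebra s gr d br vac nop + odd_operator s gr d br D
  for s :: "complex \<Rightarrow> 'v::ab_group_add \<Rightarrow> 'v" and gr d br vac nop D
begin

definition nop_leibniz :: "'v \<Rightarrow> bool" where
  "nop_leibniz a \<longleftrightarrow> (\<forall>b. D (nop a b) = nop (D a) b + nop (parity_op gr a) (D b))"

lemma nop_leibniz_hom:
  "a \<in> gr p \<Longrightarrow> nop_leibniz a \<longleftrightarrow> (\<forall>b. D (nop a b) = nop (D a) b + psign p (nop a (D b)))"
  by (simp add: nop_leibniz_def parity_op_hom nop_psign_left)

lemma nop_leibnizD: "nop_leibniz a \<Longrightarrow> D (nop a b) = nop (D a) b + nop (parity_op gr a) (D b)"
  by (simp add: nop_leibniz_def)

lemma subspace_nop_leibniz: "subspace {a. nop_leibniz a}"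
proof -
  have "subspace {a. D (nop a b) = nop (D a) b + nop (parity_op gr a) (D b)}" for b
    by (rule subspace_additive_eq[where h = s,
        OF additive_comp[OF additive_D additive_nop_left]
          additive_plus[OF additive_comp[OF additive_nop_left additive_D]
            additive_comp[OF additive_nop_left additive_parity_op]]])
      (simp_all add: nop_scale_left linear_scale'[OF D_lin] linear_scale'[OF parity_op_linear]
        scale_right_distrib)
  then show ?thesis unfolding nop_leibniz_def subspace_def by simp
qed

text \<open>Needed because the correction terms of quasi-associativity contain derivatives
  \<partial>^m a. The product with \<partial>a is \<partial> of the product with a, minus the
  product of a with a derivative, and D commutes with \<partial>.\<close>

lemma nop_leibniz_d: "nop_leibniz a \<Longrightarrow> nop_leibniz (d a)"
proof -
  assume a: "nop_leibniz a"
  have eq: "nop (d a) b = d (nop a b) - nop a (d b)" for a b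
    by (simp add: d_derivation)
  show "nop_leibniz (d a)"
    unfolding nop_leibniz_def D_d d_parity_op[symmetric] eq additive.diff[OF additive_D]
      nop_leibnizD[OF a] additive.add[OF additive_d]
    by simp
qed

lemma nop_leibniz_funpow: "nop_leibniz a \<Longrightarrow> nop_leibniz ((d ^^ n) a)"
  by (induction n) (simp_all add: nop_leibniz_d)

lemma D_assoc_term:
  assumes a: "nop_leibniz a" "a \<in> gr p"
  shows "D (assoc_term a P) = assoc_term (D a) P + psign p (assoc_term a (map_poly D P))"
proof -
  have "D ((d ^^ m) a) = (d ^^ m) (D a)" for m
    by (induction m) (simp_all add: D_d)
  moreover have "(d ^^ m) a \<in> gr p" for m
    by (induction m) (simp_all add: a d_gr)
  ultimately have "D (nop ((d ^^ m) a) x) = nop ((d ^^ m) (D a)) x + psign p (nop ((d ^^ m) a) (D x))" for m x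
    using nop_leibniz_hom nop_leibniz_funpow[OF a(1)] by metis
  then have *: "D (neg_prod s d nop m a (s k x)) =
      neg_prod s d nop m (D a) (s k x) + psign p (neg_prod s d nop m a (s k (D x)))" for m k x
    by (simp add: neg_prod_def linear_scale'[OF D_lin] scale_right_distrib scale_psign)
  have "psum (\<lambda>j x. psign p (neg_prod s d nop (j + 1) a (s (fact j) (D x)))) P =
      psign p (assoc_term a (map_poly D P))"
    unfolding assoc_term_def
    by (subst psum_map_poly)
      (simp_all add: additive_apply_psum[OF additive_psign] additive.zero[OF additive_neg_prod_term, simplified])
  then show ?thesis
    by (simp add: assoc_term_def additive_apply_psum[OF additive_D] * psum_fun_add)
qed

text \<open>Quasi-associativity unfolds (ab)c, (Da b)c and (a Db)c into nested products and
  correction terms. The corrections contain the brackets of a and b with c, which is where the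
  bracket rule enters the product rule.\<close>

lemma nop_leibniz_nop:
  assumes p: "a \<in> gr p" and q: "b \<in> gr q" and P: "nop_leibniz a" "nop_leibniz b"
    and Q: "\<And>c. leibniz a c" "\<And>c. leibniz b c"
  shows "nop_leibniz (nop a b)"
proof -
  note at = additive.add[OF additive_assoc_term] additive.minus[OF additive_assoc_term]
    additive.diff[OF additive_assoc_term]
  have Qa: "\<And>c. map_poly D (br a c) = br (D a) c + psign p (br a (D c))"
    and Qb: "\<And>c. map_poly D (br b c) = br (D b) c + psign q (br b (D c))"
    and Pa: "\<And>c. D (nop a c) = nop (D a) c + psign p (nop a (D c))"
    and Pb: "\<And>c. D (nop b c) = nop (D b) c + psign q (nop b (D c))"
    using P Q nop_leibniz_hom leibniz_hom p q by blast+
  show ?thesis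
    unfolding nop_leibniz_hom[OF nop_parity[OF p q]]
  proof
    fix c
    show "D (nop (nop a b) c) = nop (D (nop a b)) c + psign (p + q) (nop (nop a b) (D c))"
      unfolding Pa Pb nop_add_left nop_psign_left nop_nop[OF p q] nop_nop[OF D_gr[OF p] q]
        nop_nop[OF p D_gr[OF q]] additive.add[OF additive_D]
      by (cases p; cases q)
        (simp_all add: psign_def D_assoc_term[OF P(1) p] D_assoc_term[OF P(2) q] Pa Pb Qa Qb at
          additive.minus[OF additive_D] nop_add_right nop_minus_right nop_diff_right algebra_simps)
  qed
qed

text \<open>The Wick formula is differentiated term by term. Its first term multiplies the
  coefficients of \<open>br a b\<close> by c and its integral brackets them with c; this is the
  origin of the last two hypotheses.\<close>

lemma leibniz_nop:
  assumes p: "a \<in> gr p" and q: "b \<in> gr q" and ab: "leibniz a b" and ac: "leibniz a c"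
    and b: "nop_leibniz b" and P: "\<And>n. nop_leibniz (coeff (br a b) n)"
    and Q: "\<And>n. leibniz (coeff (br a b) n) c"
  shows "leibniz a (nop b c)"
proof -
  define N where "N c = map_poly (\<lambda>x. nop x c)" for c
  define M where "M b = map_poly (nop b)" for b
  define L where "L c P = pint_lambda s (map_poly (\<lambda>x. br x c) P)" for c P
  have N: "additive (N c)" for c
    unfolding N_def by (rule additive_map_poly[OF additive_nop_left])
  have M: "additive (M b)" for b
    unfolding M_def by (rule additive_map_poly[OF additive_nop_right])
  have L: "additive (L c)" for c
    unfolding L_def by (rule additive_comp[OF additive_pint_lambda additive_map_poly[OF additive_br_left]])
  note add = additive.add[OF N] additive.add[OF M] additive.add[OF L]
    additive.minus[OF N] additive.minus[OF M] additive.minus[OF L]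
    additive.diff[OF N] additive.diff[OF M] additive.diff[OF L]
  have wick': "br x (nop y z) = N z (br x y) + psign (p * q) (M y (br x z)) + L z (br x y)"
    if "x \<in> gr p" "y \<in> gr q" for x y z p q
    unfolding N_def M_def L_def by (rule wick[OF that])
  have sig: "map_poly (parity_op gr) (br a b) = psign (p + q) (br a b)"
    unfolding br_parity_op parity_op_hom[OF p] parity_op_hom[OF q] br_psign_left br_psign_right
    by (cases p; cases q) (simp_all add: psign_def)
  have ab': "map_poly D (br a b) = br (D a) b + psign p (br a (D b))"
    and ac': "map_poly D (br a c) = br (D a) c + psign p (br a (D c))"
    and b': "\<And>c. D (nop b c) = nop (D b) c + psign q (nop b (D c))"
    using ab ac b leibniz_hom[OF p] nop_leibniz_hom[OF q] by blast+
  have "map_poly D (N c (br a b)) =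
      N c (map_poly D (br a b)) + N (D c) (map_poly (parity_op gr) (br a b))"
    unfolding N_def
    by (intro poly_eqI) (simp add: coeff_map_poly nop_zero_left nop_leibnizD[OF P]
      additive.zero[OF additive_parity_op])
  then have 1: "map_poly D (N c (br a b)) =
      N c (map_poly D (br a b)) + psign (p + q) (N (D c) (br a b))"
    unfolding sig by (simp only: psign_apply[OF N] psign_apply[OF L])
  have 2: "map_poly D (M b (br a c)) = M (D b) (br a c) + psign q (M b (map_poly D (br a c)))"
    unfolding M_def
    by (intro poly_eqI) (simp add: coeff_map_poly nop_zero_right b' psign_def)
  have "map_poly (map_poly D) (map_poly (\<lambda>x. br x c) (br a b)) =
      map_poly (\<lambda>x. br x c) (map_poly D (br a b)) +
      map_poly (\<lambda>x. br x (D c)) (map_poly (parity_op gr) (br a b))"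
    by (intro poly_eqI) (simp add: coeff_map_poly br_zero_left Q[unfolded leibniz_def]
      additive.zero[OF additive_parity_op])
  then have "map_poly D (L c (br a b)) =
      L c (map_poly D (br a b)) + L (D c) (map_poly (parity_op gr) (br a b))"
    unfolding L_def linear_map_pint_lambda[OF D_lin]
    by (simp add: additive.add[OF additive_pint_lambda])
  then have 3: "map_poly D (L c (br a b)) =
      L c (map_poly D (br a b)) + psign (p + q) (L (D c) (br a b))"
    unfolding sig by (simp only: psign_apply[OF N] psign_apply[OF L])
  show ?thesis
    unfolding leibniz_hom[OF p] b' br_add_right br_psign_right wick'[OF p q]
      wick'[OF D_gr[OF p] q] wick'[OF p D_gr[OF q]] map_poly_add_poly[OF additive_D]
      map_poly_psign[OF additive_D] 1 2 3 ab' ac'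
    by (cases p; cases q) (simp_all add: psign_def add algebra_simps)
qed

end

section \<open>The SUSY axioms\<close>

lemma times_lam_eq: "times_lam w = (pCons 0 (fst w), pCons 0 (snd w))"
  by (cases w) simp

lemma times_chi_eq: "times_chi w = (- pCons 0 (snd w), fst w)"
  by (cases w) simp

lemma lift_spoly_eq: "lift_spoly k f w = (map_poly f (fst w), psign k (map_poly f (snd w)))"
  by (cases w) simp

lemma additive_times_lam: "additive times_lam"
  by unfold_locales (simp add: times_lam_eq)

lemma additive_times_chi: "additive times_chi"
  by unfold_locales (simp add: times_chi_eq)

lemma additive_lift_spoly: "additive f \<Longrightarrow> additive (lift_spoly k f)"
  by unfold_locales (simp add: lift_spoly_eq map_poly_add_poly additive.add[OF additive_psign])

lemma times_chi_chi: "times_chi (times_chi w) = - times_lam w"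
  by (simp add: times_chi_eq times_lam_eq prod_eq_iff)

lemma times_chi_lam: "times_chi (times_lam w) = times_lam (times_chi w)"
  by (simp add: times_chi_eq times_lam_eq)

lemma eta_chi: "lift_spoly 1 times_chi (times_chi w) = - times_chi (lift_spoly 1 times_chi w)"
  by (simp add: lift_spoly_eq times_chi_eq[of w] times_chi_eq[of "(_, _)"] psign_def prod_eq_iff
    map_poly_uminus[OF additive_times_chi] map_poly_pCons_0 additive.zero[OF additive_times_chi])

lemma eta_lam: "lift_spoly 1 times_chi (times_lam w) = times_lam (lift_spoly 1 times_chi w)"
  by (simp add: lift_spoly_eq times_lam_eq psign_def prod_eq_iff
    map_poly_pCons_0 additive.zero[OF additive_times_chi])

lemma chi_gam: "times_chi (lift_spoly 0 times_lam w) = lift_spoly 0 times_lam (times_chi w)"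
  by (simp add: lift_spoly_eq times_chi_eq psign_def prod_eq_iff
    map_poly_uminus[OF additive_times_lam] map_poly_pCons_0 additive.zero[OF additive_times_lam])

text \<open>\<open>poly_emb\<close> embeds \<open>\<complex>[\<lambda>, \<gamma>] \<otimes> V\<close> into \<open>\<complex>[\<Lambda>, \<Gamma>] \<otimes> V\<close>. Writing both sides of the SUSY Jacobi
  identity as \<open>A + \<chi> B + \<eta> C + \<chi> \<eta> E\<close> with \<open>A\<close>, \<open>B\<close>, \<open>C\<close>, \<open>E\<close> in its image splits the identity into four
  ordinary Jacobi identities.\<close>

definition poly_emb :: "'v::ab_group_add poly poly \<Rightarrow> 'v spoly spoly" where
  "poly_emb Q = (map_poly (\<lambda>q. (q, 0)) Q, 0)"

lemma additive_poly_emb: "additive poly_emb"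
proof
  fix P Q :: "'a poly poly"
  have "additive (\<lambda>q::'a poly. (q, 0::'a poly))" by unfold_locales simp
  then show "poly_emb (P + Q) = poly_emb P + poly_emb Q"
    by (simp add: poly_emb_def map_poly_add_poly)
qed

lemma poly_emb_const: "spoly_const (spoly_const x) = poly_emb [:[:x:]:]"
  by (simp add: poly_emb_def spoly_const_def map_poly_pCons zero_prod_def)

lemma poly_emb_lam: "poly_emb (pCons 0 Q) = times_lam (poly_emb Q)"
  by (simp add: poly_emb_def map_poly_pCons_0 zero_prod_def)

lemma poly_emb_gam: "poly_emb (map_poly (pCons 0) Q) = lift_spoly 0 times_lam (poly_emb Q)"
  by (simp add: poly_emb_def map_poly_comp zero_prod_def psign_def)

text \<open>Applied with \<open>h\<close> the identity, \<chi> or \<eta>, one for each kind of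
  summand.\<close>

lemma subst_lambda_poly_emb:
  assumes "additive h" "\<And>x. h (T' x) = T' (h x)" and "\<And>x. poly_emb (T x) = T' (poly_emb x)"
  shows "subst_lambda T' (\<lambda>x. h (poly_emb (f x))) P = h (poly_emb (subst_lambda T f P))"
  by (rule subst_lambda_hom[where h = "\<lambda>x. h (poly_emb x)", symmetric])
    (simp_all add: assms additive_comp[OF assms(1) additive_poly_emb])

lemmas subst_lambda_poly_emb_id = subst_lambda_poly_emb[OF additive_id refl]

context vertex_odd_operator
begin

text \<open>The coefficient of \<chi> is ordinary skew-symmetry. In the constant term, substituting
  -D - \<chi> for \<chi> subtracts D of the bracket of a, b from that of Da, b; by the Leibniz rule
  only the bracket of a and Db survives.\<close>

lemma sbr_skew_leibniz:
  assumes Q: "\<And>a b. leibniz a b" and a: "a \<in> gr p" and b: "b \<in> gr q"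
  shows "(br (D b) a, br b a) = psign (p * q)
    (subst_Lambda (\<lambda>P. - lift_spoly 0 d P - times_lam P) (\<lambda>P. - D_spoly D P - times_chi P)
      spoly_const (br (D a) b, br a b))"
proof -
  have T: "subst_lambda (\<lambda>P. - lift_spoly 0 d P - times_lam P) spoly_const P = (skew_subst P, 0)" for P
  proof -
    have "(skew_subst P, 0) =
        subst_lambda (\<lambda>P. - lift_spoly 0 d P - times_lam P) (\<lambda>x. ([:x:], 0)) P"
      unfolding skew_subst_def
      by (rule subst_lambda_hom[where h = "\<lambda>x. (x, 0)"])
        (unfold_locales, simp_all add: psign_def)
    then show ?thesis by (simp add: spoly_const_def[abs_def])
  qed
  have ab: "map_poly D (br a b) = br (D a) b + psign p (br a (D b))"
    using Q leibniz_hom[OF a] by blast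
  have "subst_Lambda (\<lambda>P. - lift_spoly 0 d P - times_lam P) (\<lambda>P. - D_spoly D P - times_chi P)
      spoly_const (br (D a) b, br a b) =
      (skew_subst (br (D a) b) - map_poly D (skew_subst (br a b)), - skew_subst (br a b))"
    by (simp add: subst_Lambda_def T)
  also have "\<dots> = (- psign p (skew_subst (br a (D b))), - skew_subst (br a b))"
    unfolding skew_subst_D ab
    by (simp add: additive.add[OF additive_skew_subst] psign_apply[OF additive_skew_subst])
  finally show ?thesis
    unfolding br_skew'[OF a b] br_skew'[OF a D_gr[OF b]]
    by (cases p; cases q) (simp_all add: psign_def)
qed

text \<open>The two components are the Wick formulas for Da and for a: \<partial>_\<eta> extracts
  the ordinary bracket with c from the \<Gamma>-bracket.\<close>

lemma sbr_wick:
  assumes a: "a \<in> gr p" and b: "b \<in> gr q"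
  shows "(br (D a) (nop b c), br a (nop b c)) =
    lift_spoly 0 (\<lambda>x. nop x c) (br (D a) b, br a b) +
    psign ((p + 1) * q) (lift_spoly q (nop b) (br (D a) c, br a c)) +
    spint_lambda s (d_eta (lift_spoly 1 (\<lambda>x. (br (D x) c, br x c)) (br (D a) b, br a b)))"
proof -
  let ?g = "\<lambda>x. (br (D x) c, br x c)"
  have g: "additive ?g" by unfold_locales (simp add: additive.add[OF additive_D] br_add_left)
  have snd: "additive (snd :: 'v poly \<times> 'v poly \<Rightarrow> _)" by unfold_locales simp
  have "map_poly snd (map_poly ?g P) = map_poly (\<lambda>x. br x c) P" for P
    by (simp add: map_poly_comp br_zero_left zero_prod_def)
  then show ?thesis
    unfolding wick[OF a b] wick[OF D_gr[OF a] b]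
    by (cases p; cases q) (simp_all add: d_eta_def psign_def map_poly_uminus[OF snd])
qed

text \<open>The parts 1, \<chi>, \<eta>, \<chi>\<eta> correspond to the Jacobi identities for (Da,
  Db), (a, Db), (Da, b), (a, b). The nested bracket on the right also contains D applied to brackets
  of a and b, which the Leibniz rule resolves.\<close>

lemma sbr_jacobi_leibniz:
  assumes Q: "\<And>a b. leibniz a b" and a: "a \<in> gr p" and b: "b \<in> gr q"
  defines "sbr \<equiv> \<lambda>a b. (br (D a) b, br a b)"
  shows "subst_Lambda sgam (\<lambda>w. psign (p + 1) (seta w))
        (\<lambda>x. subst_Lambda times_lam times_chi sconst2 (sbr a x)) (sbr b c) =
      psign (p + 1)
        (subst_Lambda times_lam (\<lambda>w. - times_chi w)
          (\<lambda>x. subst_Lambda (\<lambda>w. times_lam w + sgam w) (\<lambda>w. times_chi w + seta w) sconst2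
             (sbr x c)) (sbr a b)) +
      psign ((p + 1) * (q + 1))
        (subst_Lambda times_lam (\<lambda>w. psign (q + 1) (times_chi w))
          (\<lambda>x. subst_Lambda sgam seta sconst2 (sbr b x)) (sbr a c))"
proof -
  define \<chi> where "\<chi> = (times_chi :: 'v spoly spoly \<Rightarrow> _)"
  define \<eta> where "\<eta> = (seta :: 'v spoly spoly \<Rightarrow> _)"
  define G where "G a x = subst_lambda lam2 const2 (br a x)" for a x
  define H where "H b x = subst_lambda gam2 const2 (br b x)" for b x
  define M where "M x = subst_lambda (\<lambda>w. lam2 w + gam2 w) const2 (br x c)" for x
  define S where "S a P = subst_lambda gam2 (G a) P" for a P
  define W where "W b P = subst_lambda lam2 (H b) P" for b P
  define N where "N P = subst_lambda lam2 M P" for P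
  let ?e = "poly_emb :: 'v poly poly \<Rightarrow> _"
  note ops = additive_times_chi[where 'a = "'v spoly", folded \<chi>_def]
    additive_lift_spoly[OF additive_times_chi[where 'a = 'v], of 1, folded \<eta>_def]
  note lam = additive_times_lam[where 'a = "'v spoly"]
  note gam = additive_lift_spoly[OF additive_times_lam[where 'a = 'v], of 0]
  have "additive (\<lambda>x::'v. const2 x)" by unfold_locales simp
  then have aM: "additive M"
    unfolding M_def by (intro additive_comp[OF additive_subst_lambda additive_br_left]
      additive_plus[OF additive_pCons_0 additive_map_poly[OF additive_pCons_0]])
  have aN: "additive N"
    unfolding N_def[abs_def] by (rule additive_subst_lambda[OF additive_pCons_0 aM])
  have gg: "additive (gam2 :: 'v poly poly \<Rightarrow> _)"
    by (rule additive_map_poly[OF additive_pCons_0])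

  have comm: "\<chi> (sgam w) = sgam (\<chi> w)" "\<chi> (times_lam w) = times_lam (\<chi> w)"
    "\<eta> (times_lam w) = times_lam (\<eta> w)" for w
    by (simp_all only: \<chi>_def \<eta>_def chi_gam times_chi_lam eta_lam)

  have LHS: "subst_Lambda sgam (\<lambda>w. psign (p + 1) (seta w))
        (\<lambda>x. subst_Lambda times_lam times_chi sconst2 (sbr a x)) (sbr b c) =
      ?e (S (D a) (br (D b) c)) + \<chi> (?e (S a (br (D b) c))) +
      psign (p + 1) (\<eta> (?e (S (D a) (br b c)) + \<chi> (?e (S a (br b c)))))"
  proof -
    have inner: "subst_Lambda times_lam times_chi sconst2 (sbr a x) = ?e (G (D a) x) + \<chi> (?e (G a x))" for x
      unfolding subst_Lambda_def sbr_def fst_conv snd_conv poly_emb_const G_def \<chi>_def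
      by (simp only: subst_lambda_poly_emb_id[where T' = times_lam, OF poly_emb_lam])
    have "subst_lambda sgam (\<lambda>x. ?e (G (D a) x) + \<chi> (?e (G a x))) P =
        ?e (S (D a) P) + \<chi> (?e (S a P))" for P
      unfolding subst_lambda_fun_add[OF gam] S_def
      by (simp only: subst_lambda_poly_emb_id[where T' = sgam, OF poly_emb_gam]
        subst_lambda_poly_emb[where T' = sgam, OF ops(1) comm(1) poly_emb_gam])
    then show ?thesis
      unfolding subst_Lambda_def[of sgam] inner by (simp add: sbr_def \<eta>_def)
  qed

  have R1: "subst_Lambda times_lam (\<lambda>w. - times_chi w)
      (\<lambda>x. subst_Lambda (\<lambda>w. times_lam w + sgam w) (\<lambda>w. times_chi w + seta w) sconst2 (sbr x c))
      (sbr a b) =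
      ?e (N (map_poly D (br (D a) b))) + \<chi> (?e (N (br (D a) b))) + \<eta> (?e (N (br (D a) b))) -
      \<chi> (?e (N (map_poly D (br a b))) + \<chi> (?e (N (br a b))) + \<eta> (?e (N (br a b))))"
  proof -
    have emb: "poly_emb (lam2 w + gam2 w) = times_lam (poly_emb w) + sgam (poly_emb w)"
      for w :: "'v poly poly"
      by (simp add: additive.add[OF additive_poly_emb] poly_emb_lam poly_emb_gam)
    have inner: "subst_Lambda (\<lambda>w. times_lam w + sgam w) (\<lambda>w. times_chi w + seta w) sconst2 (sbr x c) =
        ?e (M (D x)) + \<chi> (?e (M x)) + \<eta> (?e (M x))" for x
      unfolding subst_Lambda_def sbr_def fst_conv snd_conv poly_emb_const M_def \<chi>_def \<eta>_def
      by (simp only: subst_lambda_poly_emb_id[where T' = "\<lambda>w. times_lam w + sgam w", OF emb] add.assoc)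
    have MD: "subst_lambda lam2 (\<lambda>x. M (D x)) P = N (map_poly D P)" for P
      unfolding N_def by (simp add: subst_lambda_map_poly[OF additive_pCons_0 aM])
    have "subst_lambda times_lam (\<lambda>x. ?e (M (D x)) + \<chi> (?e (M x)) + \<eta> (?e (M x))) P =
        ?e (N (map_poly D P)) + \<chi> (?e (N P)) + \<eta> (?e (N P))" for P
      unfolding subst_lambda_fun_add[OF lam]
      by (simp only: subst_lambda_poly_emb_id[where T' = times_lam, OF poly_emb_lam]
        subst_lambda_poly_emb[where T' = times_lam, OF ops(1) comm(2) poly_emb_lam]
        subst_lambda_poly_emb[where T' = times_lam, OF ops(2) comm(3) poly_emb_lam]
        MD) (simp only: N_def)
    then show ?thesis
      unfolding subst_Lambda_def[of times_lam] inner by (simp add: sbr_def \<chi>_def)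
  qed

  have R2: "subst_Lambda times_lam (\<lambda>w. psign (q + 1) (times_chi w))
          (\<lambda>x. subst_Lambda sgam seta sconst2 (sbr b x)) (sbr a c) =
      ?e (W (D b) (br (D a) c)) + \<eta> (?e (W b (br (D a) c))) +
      psign (q + 1) (\<chi> (?e (W (D b) (br a c)) + \<eta> (?e (W b (br a c)))))"
  proof -
    have inner: "subst_Lambda sgam seta sconst2 (sbr b x) = ?e (H (D b) x) + \<eta> (?e (H b x))" for x
      unfolding subst_Lambda_def sbr_def fst_conv snd_conv poly_emb_const H_def \<eta>_def
      by (simp only: subst_lambda_poly_emb_id[where T' = sgam, OF poly_emb_gam])
    have "subst_lambda times_lam (\<lambda>x. ?e (H (D b) x) + \<eta> (?e (H b x))) P =
        ?e (W (D b) P) + \<eta> (?e (W b P))" for P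
      unfolding subst_lambda_fun_add[OF lam] W_def
      by (simp only: subst_lambda_poly_emb_id[where T' = times_lam, OF poly_emb_lam]
        subst_lambda_poly_emb[where T' = times_lam, OF ops(2) comm(3) poly_emb_lam])
    then show ?thesis
      unfolding subst_Lambda_def[of times_lam] inner by (simp add: sbr_def \<chi>_def)
  qed

  have jacobi: "S x (br y c) = N (br x y) + psign (p * q) (W y (br x c))"
    if "x \<in> gr p" "y \<in> gr q" for x y p q
    unfolding S_def G_def N_def M_def W_def H_def by (rule br_jacobi[OF that])
  have ab: "map_poly D (br a b) = br (D a) b + psign p (br a (D b))"
    using Q leibniz_hom[OF a] by blast
  \<comment> \<open>The summand with \<lambda> cancels against the one that \<chi>\<chi> =
    -\<lambda> produces in \<open>R1\<close>.\<close>
  have Dab: "map_poly D (br (D a) b) = - pCons 0 (br a b) + psign (p + 1) (br (D a) (D b))"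
    using Q leibniz_hom[OF D_gr[OF a]] by (metis D_square br_d_left)
  have Nlam: "?e (N (pCons 0 P)) = times_lam (?e (N P))" for P
    unfolding N_def subst_lambda_pCons_0[OF additive_pCons_0 aM] poly_emb_lam ..
  have rel: "\<chi> (\<chi> w) = - times_lam w" "\<eta> (\<chi> w) = - \<chi> (\<eta> w)" for w
    by (simp_all add: \<chi>_def \<eta>_def times_chi_chi eta_chi)
  note add = additive.add[OF ops(1)] additive.add[OF ops(2)] additive.add[OF aN]
    additive.add[OF additive_poly_emb] psign_apply[OF ops(1)] psign_apply[OF ops(2)]
    psign_apply[OF aN] psign_apply[OF additive_poly_emb] additive.minus[OF ops(1)]
    additive.minus[OF ops(2)] additive.minus[OF aN] additive.minus[OF additive_poly_emb]
    additive.diff[OF ops(1)] additive.diff[OF ops(2)] additive.diff[OF aN]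
    additive.diff[OF additive_poly_emb]
  show ?thesis
    unfolding LHS R1 R2 jacobi[OF a b] jacobi[OF D_gr[OF a] b] jacobi[OF a D_gr[OF b]]
      jacobi[OF D_gr[OF a] D_gr[OF b]] ab Dab add Nlam rel
    by (cases p; cases q) (simp_all add: psign_def add algebra_simps)
qed

theorem n1_susy_of_leibniz:
  assumes P: "\<And>a. nop_leibniz a" and Q: "\<And>a b. leibniz a b"
  shows "n1_susy_vertex_algebra s gr d vac nop D (\<lambda>a b. (br (D a) b, br a b))"
proof unfold_locales
  show "odd_derivation s gr nop D"
    unfolding odd_derivation_def using D_odd P nop_leibniz_hom by blast
next
  fix a show "D (D a) = d a" by (rule D_square)
next
  fix a b p assume a: "a \<in> gr p"
  have "map_poly D (br a b) = br (D a) b + psign p (br a (D b))"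
    "map_poly D (br (D a) b) = - pCons 0 (br a b) + psign (p + 1) (br (D a) (D b))"
    using Q leibniz_hom[OF a] leibniz_hom[OF D_gr[OF a]] by (metis D_square br_d_left)+
  then show "(br (D a) (D b), br a (D b)) = psign (p + 1)
      (D_spoly D (br (D a) b, br a b) + times_chi (br (D a) b, br a b))"
    by (cases p) (simp_all add: psign_def algebra_simps)
next
  fix a b p q m assume "a \<in> gr p" "b \<in> gr q"
  note br_parity[OF D_gr[OF this(1)] this(2), of m] br_parity[OF this, of m]
  then show "coeff (fst (br (D a) b, br a b)) m \<in> gr (p + q + 1) \<and>
      coeff (snd (br (D a) b, br a b)) m \<in> gr (p + q)"
    by (simp only: fst_conv snd_conv add_ac)
next
  fix a b p q assume "a \<in> gr p" "b \<in> gr q"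
  then show "(br (D b) a, br b a) = psign (p * q)
    (subst_Lambda (\<lambda>P. - lift_spoly 0 d P - times_lam P) (\<lambda>P. - D_spoly D P - times_chi P)
      spoly_const (br (D a) b, br a b))"
    by (rule sbr_skew_leibniz[OF Q])
qed (simp_all only: snd_conv quasi_comm quasi_assoc sbr_wick sbr_jacobi_leibniz[OF Q],
  simp_all add: additive.add[OF additive_D] br_add_left br_add_right br_scale_left br_scale_right
    linear_scale'[OF D_lin] D_square br_d_left psign_def)

end

section \<open>Extension to the enveloping vertex algebra\<close>

locale enveloping_odd_derivation =
  universal_enveloping_vertex_algebra s gr d br sV grV dV brV vac nop \<iota> +
  R: odd_operator s gr d br D
  for s :: "complex \<Rightarrow> 'r::ab_group_add \<Rightarrow> 'r" and gr d br
    and sV :: "complex \<Rightarrow> 'v::ab_group_add \<Rightarrow> 'v" and grV dV brV vac nop \<iota> D +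
  assumes R_leibniz: "R.leibniz a b"
begin

abbreviation "\<sigma> \<equiv> parity_op gr"
abbreviation "\<sigma>V \<equiv> parity_op grV"

lemma incl_lin: "Vector_Spaces.linear s sV \<iota>"
  using incl_even by (simp add: linear_of_parity_def)

lemmas additive_incl = linear_additive[OF incl_lin]

lemma incl_gr: "a \<in> gr p \<Longrightarrow> \<iota> a \<in> grV p"
  using incl_even unfolding linear_of_parity_def add_0_right by blast

lemma incl_parity_op: "\<iota> (\<sigma> a) = \<sigma>V (\<iota> a)"
  using parity_op_commute[OF incl_even R.super_vector_space_axioms V.super_vector_space_axioms]
  by (simp add: psign_def)

text \<open>By quasi-commutativity and quasi-associativity, \<open>V\<close> is a representation of the Lie superalgebra
  \<open>R\<close> with the bracket \<open>\<integral>\<^sub>-\<^sub>\<partial>\<^sup>0 [a \<^sub>\<lambda> b] d\<lambda>\<close>, where \<open>a\<close> acts as \<open>x \<mapsto> :ax:\<close>.\<close>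

abbreviation lie_br :: "'r \<Rightarrow> 'r \<Rightarrow> 'r" where
  "lie_br a b \<equiv> int_neg_d s d (br a b)"

lemma incl_lie_br: "\<iota> (lie_br a b) = int_neg_d sV dV (brV (\<iota> a) (\<iota> b))"
  unfolding incl_br by (rule int_neg_d_hom[where d = d, OF incl_lin incl_d V.additive_d])

lemma D_lie_br: "D (lie_br a b) = lie_br (D a) b + lie_br (\<sigma> a) (D b)"
  unfolding int_neg_d_hom[where d = d, OF R.D_lin R.D_d R.additive_d]
    R_leibniz[unfolded R.leibniz_def] by (rule additive.add[OF R.additive_int_neg_d])

lemma lie_br_psign_left: "lie_br (psign p a) b = psign p (lie_br a b)"
  unfolding R.br_psign_left by (rule psign_apply[OF R.additive_int_neg_d])

lemma parity_op_lie_br: "\<sigma> (lie_br a b) = lie_br (\<sigma> a) (\<sigma> b)"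
  unfolding R.br_parity_op[symmetric]
  by (rule int_neg_d_hom[where d = d, OF R.parity_op_linear R.d_parity_op[symmetric] R.additive_d])

lemma incl_nop_commute:
  assumes "a \<in> gr p" "b \<in> gr q"
  shows "nop (\<iota> a) (nop (\<iota> b) x) =
    psign (p * q) (nop (\<iota> b) (nop (\<iota> a) x)) + nop (\<iota> (lie_br a b)) x"
  unfolding incl_lie_br by (rule V.nop_left_commute[OF incl_gr[OF assms(1)] incl_gr[OF assms(2)]])

definition pair_scale :: "complex \<Rightarrow> 'v \<times> 'v \<Rightarrow> 'v \<times> 'v" where
  "pair_scale k x = (sV k (fst x), sV k (snd x))"

text \<open>The derivation is constructed as a graph: it is the \<open>R\<close>-submodule of \<open>V \<times> V\<close> generated by
  \<open>(|0\<rangle>, 0)\<close> under the following action. By straightening in \<open>V \<times> V\<close> it is spanned by its sorted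
  monomials, whose first components are the PBW basis of \<open>V\<close>.\<close>

definition pair_action :: "'r \<Rightarrow> 'v \<times> 'v \<Rightarrow> 'v \<times> 'v" where
  "pair_action a x = (nop (\<iota> a) (fst x), nop (\<iota> (D a)) (fst x) + nop (\<iota> (\<sigma> a)) (snd x))"

lemma vector_space_pair_scale: "vector_space pair_scale"
  by unfold_locales
    (simp_all add: pair_scale_def V.scale_right_distrib V.scale_left_distrib prod_eq_iff)

lemma pair_action_lin_left: "Vector_Spaces.linear s pair_scale (\<lambda>a. pair_action a x)"
proof -
  have "additive (\<lambda>a. pair_action a x)"
    by unfold_locales (simp add: pair_action_def additive.add[OF additive_incl] V.nop_add_left
      additive.add[OF R.additive_D] additive.add[OF R.additive_parity_op])
  moreover have "pair_action (s k a) x = pair_scale k (pair_action a x)" for k a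
    by (simp add: pair_action_def pair_scale_def linear_scale'[OF incl_lin] V.nop_scale_left
      linear_scale'[OF R.D_lin] linear_scale'[OF R.parity_op_linear] V.scale_right_distrib)
  ultimately show ?thesis
    using R.vector_space_axioms vector_space_pair_scale
    by (simp add: Vector_Spaces.linear_def module_hom_iff module_iff_vector_space additive_def)
qed

lemma pair_action_lin_right: "Vector_Spaces.linear pair_scale pair_scale (pair_action a)"
proof -
  have "additive (pair_action a)"
    by unfold_locales (simp add: pair_action_def V.nop_add_right)
  moreover have "pair_action a (pair_scale k x) = pair_scale k (pair_action a x)" for k x
    by (simp add: pair_action_def pair_scale_def V.nop_scale_right V.scale_right_distrib)
  ultimately show ?thesis
    using vector_space_pair_scale
    by (simp add: Vector_Spaces.linear_def module_hom_iff module_iff_vector_space additive_def)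
qed

text \<open>The second component is the formal derivative of the commutation rule in V. It holds
  because D, commuting with \<partial>, is an odd derivation not only of the \<lambda>-bracket but
  also of its integral \<open>lie_br\<close>.\<close>

lemma pair_action_commute:
  assumes p: "a \<in> gr p" and q: "b \<in> gr q"
  shows "pair_action a (pair_action b x) =
    psign (p * q) (pair_action b (pair_action a x)) + pair_action (lie_br a b) x"
proof -
  have 1: "D (lie_br a b) = lie_br (D a) b + psign p (lie_br a (D b))"
    unfolding D_lie_br R.parity_op_hom[OF p] lie_br_psign_left ..
  have 2: "\<sigma> (lie_br a b) = psign (p + q) (lie_br a b)"
    unfolding parity_op_lie_br R.parity_op_hom[OF p] R.parity_op_hom[OF q] R.br_psign_left
      R.br_psign_right psign_apply[OF R.additive_int_neg_d]
    by (cases p; cases q) (simp_all add: psign_def)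
  show ?thesis
    unfolding pair_action_def fst_conv snd_conv 1 2 R.parity_op_hom[OF p] R.parity_op_hom[OF q]
      psign_apply[OF additive_incl] additive.add[OF additive_incl] V.nop_add_right V.nop_add_left
      V.nop_psign_left V.nop_psign_right
      incl_nop_commute[OF p q] incl_nop_commute[OF R.D_gr[OF p] q] incl_nop_commute[OF p R.D_gr[OF q]]
    by (cases p; cases q) (simp_all add: psign_def prod_eq_iff algebra_simps)
qed

lemma foldr_pair_action: "fst (foldr pair_action xs (vac, 0)) = nop_monomial nop vac (map \<iota> xs)"
  by (induction xs) (simp_all add: nop_monomial_def pair_action_def)

lemma enveloping_derivation_exists:
  "\<exists>E. Vector_Spaces.linear sV sV E \<and> E vac = 0 \<and>
    (\<forall>a x. E (nop (\<iota> a) x) = nop (\<iota> (D a)) x + nop (\<iota> (\<sigma> a)) (E x))"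
proof -
  obtain B r where B: "B \<subseteq> gr 0 \<union> gr 1" "R.span B = UNIV" "linear_order_on B r"
    and inj: "inj_on (\<lambda>xs. nop_monomial nop vac (map \<iota> xs)) (pbw_lists gr B r)"
    and ind: "V.independent ((\<lambda>xs. nop_monomial nop vac (map \<iota> xs)) ` pbw_lists gr B r)"
    and span: "V.span ((\<lambda>xs. nop_monomial nop vac (map \<iota> xs)) ` pbw_lists gr B r) = UNIV"
    using pbw by blast
  let ?pbw = "pbw_lists gr B r"
  let ?mon = "\<lambda>xs. nop_monomial nop vac (map \<iota> xs)"
  let ?pair = "\<lambda>xs. foldr pair_action xs (vac, 0)"
  interpret A: super_lie_action s gr pair_scale pair_action lie_br "(vac, 0)" B r
  proof (intro super_lie_action.intro super_lie_action_axioms.intro)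
    show "super_vector_space s gr" by unfold_locales
  qed (rule vector_space_pair_scale pair_action_lin_left pair_action_lin_right B | erule (1) pair_action_commute)+
  interpret VP: vector_space_pair sV sV by unfold_locales
  obtain E where E: "Vector_Spaces.linear sV sV E"
    and E_mon: "\<And>x. x \<in> ?mon ` ?pbw \<Longrightarrow> E x = snd (?pair (inv_into ?pbw ?mon x))"
    using VP.linear_independent_extend[OF ind, of "\<lambda>x. snd (?pair (inv_into ?pbw ?mon x))"] by blast
  have Emon: "E (?mon xs) = snd (?pair xs)" if "xs \<in> ?pbw" for xs
    using E_mon[OF imageI[OF that]] inv_into_f_f[OF inj that] by simp
  note Ea = linear_additive[OF E] and Es = linear_scale'[OF E]
  \<comment> \<open>\<open>?K\<close> is exactly the graph of \<open>E\<close>: it lies in the graph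
    because its spanning set does, and it exhausts the graph because the first entries span V.
    Invariance of the graph under \<open>pair_action\<close> is then the Leibniz rule.\<close>
  let ?K = "A.M.span (?pair ` ?pbw)"
  have "A.M.subspace {x. E (fst x) = snd x}"
    by (auto simp: A.M.subspace_def additive.zero[OF Ea] additive.add[OF Ea] Es pair_scale_def)
  moreover have "?pair ` ?pbw \<subseteq> {x. E (fst x) = snd x}"
    using Emon foldr_pair_action by auto
  ultimately have graph: "E (fst x) = snd x" if "x \<in> ?K" for x
    using A.M.span_minimal that by blast
  have "V.subspace {x. (x, E x) \<in> ?K}"
  proof -
    have "(0, 0) \<in> ?K" using A.M.span_zero by (simp add: zero_prod_def)
    moreover have "(x + y, E x + E y) \<in> ?K" if "(x, E x) \<in> ?K" "(y, E y) \<in> ?K" for x y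
      using A.M.span_add[OF that] by simp
    moreover have "(sV k x, sV k (E x)) \<in> ?K" if "(x, E x) \<in> ?K" for k x
      using A.M.span_scale[OF that, of k] by (simp add: pair_scale_def)
    ultimately show ?thesis
      by (simp add: V.subspace_def additive.zero[OF Ea] additive.add[OF Ea] Es)
  qed
  moreover have "?mon ` ?pbw \<subseteq> {x. (x, E x) \<in> ?K}"
  proof clarify
    fix xs assume xs: "xs \<in> ?pbw"
    have "(?mon xs, E (?mon xs)) = ?pair xs"
      using foldr_pair_action Emon[OF xs] by (simp add: prod_eq_iff)
    then show "(?mon xs, E (?mon xs)) \<in> ?K" using xs by (simp add: A.M.span_base)
  qed
  ultimately have K: "(x, E x) \<in> ?K" for x
    using V.span_minimal span by blast
  have "E (nop (\<iota> a) x) = nop (\<iota> (D a)) x + nop (\<iota> (\<sigma> a)) (E x)" for a x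
    using graph[OF A.pbw_span_invariant[OF K[of x], of a]] by (simp add: pair_action_def)
  moreover have "E vac = 0"
    using Emon[of "[]"] by (simp add: pbw_lists_def nop_monomial_def)
  ultimately show ?thesis using E by blast
qed

lemma enveloping_induct:
  assumes X: "V.subspace X" and "vac \<in> X" "\<And>p a x. a \<in> gr p \<Longrightarrow> x \<in> X \<Longrightarrow> nop (\<iota> a) x \<in> X"
  shows "x \<in> X"
proof -
  obtain B r where B: "B \<subseteq> gr 0 \<union> gr 1"
    and span: "V.span ((\<lambda>xs. nop_monomial nop vac (map \<iota> xs)) ` pbw_lists gr B r) = UNIV"
    using pbw by blast
  have "nop_monomial nop vac (map \<iota> xs) \<in> X" if "set xs \<subseteq> B" for xs
    using that by (induction xs) (use assms B in \<open>auto simp: nop_monomial_def\<close>)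
  then have "(\<lambda>xs. nop_monomial nop vac (map \<iota> xs)) ` pbw_lists gr B r \<subseteq> X"
    by (auto simp: pbw_lists_def)
  then show ?thesis using V.span_minimal[OF _ X] span by blast
qed

end

locale enveloping_extension = enveloping_odd_derivation +
  fixes E :: "'b \<Rightarrow> 'b"
  assumes E_lin: "Vector_Spaces.linear sV sV E" and E_vac: "E vac = 0"
    and E_nop: "E (nop (\<iota> a) x) = nop (\<iota> (D a)) x + nop (\<iota> (\<sigma> a)) (E x)"
begin

lemmas additive_E = linear_additive[OF E_lin]

lemma E_incl: "E (\<iota> a) = \<iota> (D a)"
  using E_nop[of a vac] by (simp add: V.vac_right E_vac V.nop_zero_right)

lemma parity_op_vac: "\<sigma>V vac = vac"
  using V.parity_op_hom[OF V.vac_even] by (simp add: psign_def)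

lemma E_parity_op: "E (\<sigma>V x) = - \<sigma>V (E x)"
proof -
  let ?X = "{x. E (\<sigma>V x) = - \<sigma>V (E x)}"
  have "V.subspace ?X"
    by (rule V.subspace_additive_eq[where h = sV, OF additive_comp[OF additive_E V.additive_parity_op]
      additive_minus[OF additive_comp[OF V.additive_parity_op additive_E]]])
      (simp_all add: linear_scale'[OF E_lin] linear_scale'[OF V.parity_op_linear])
  moreover have "vac \<in> ?X"
    by (simp add: parity_op_vac E_vac additive.zero[OF V.additive_parity_op])
  moreover have "nop (\<iota> a) x \<in> ?X" if "x \<in> ?X" for a x
    using that
    by (simp add: V.nop_parity_op E_nop incl_parity_op[symmetric] R.D_parity_op
      additive.add[OF V.additive_parity_op] additive.minus[OF additive_incl] V.nop_minus_left
      V.nop_minus_right)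
  ultimately show ?thesis using enveloping_induct[of ?X x] by blast
qed

text \<open>An operator anticommuting with the parity operator exchanges its eigenspaces: the
  component of the wrong parity is its own negative.\<close>

lemma E_gr: "x \<in> grV p \<Longrightarrow> E x \<in> grV (p + 1)"
proof -
  assume x: "x \<in> grV p"
  obtain y z where yz: "y \<in> grV 0" "z \<in> grV 1" "E x = y + z" using V.gr_decomp by blast
  have "E (\<sigma>V x) = psign p (E x)"
    unfolding V.parity_op_hom[OF x] by (rule psign_apply[OF additive_E])
  then have eq: "psign p (y + z) = z - y"
    unfolding E_parity_op yz(3) V.parity_op_sum[OF yz(1,2)] by simp
  have half: "w = 0" if "w + w = 0" for w :: 'b
  proof -
    have "sV 2 w = 0" using V.scale_left_distrib[of 1 1 w] that by simp
    then show ?thesis by simp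
  qed
  show ?thesis
  proof (cases p)
    case zero
    then have "y + y = 0" using eq by (simp add: psign_def algebra_simps)
    then have "y = 0" by (rule half)
    then show ?thesis using yz zero by simp
  next
    case one
    then have "- z = z" using eq by (simp add: psign_def)
    then have "z + z = 0" by (metis add.right_inverse)
    then have "z = 0" by (rule half)
    then show ?thesis using yz one by simp
  qed
qed

lemma E_odd: "linear_of_parity 1 sV grV sV grV E"
  unfolding linear_of_parity_def using E_lin E_gr by blast

text \<open>When E is applied twice to a product, the two mixed terms cancel because D anticommutes
  with the parity operator.\<close>

lemma E_square: "E (E x) = dV x"
proof -
  let ?X = "{x. E (E x) = dV x}"
  have "V.subspace ?X"
    by (rule V.subspace_additive_eq[where h = sV, OF additive_comp[OF additive_E additive_E] V.additive_d])
      (simp_all add: linear_scale'[OF E_lin] linear_scale'[OF V.d_lin])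
  moreover have "vac \<in> ?X"
    by (simp add: E_vac additive.zero[OF additive_E] V.d_vac)
  moreover have "nop (\<iota> a) x \<in> ?X" if "x \<in> ?X" for a x
    using that
    by (simp add: E_nop additive.add[OF additive_E] R.D_square V.d_derivation incl_d
      R.D_parity_op R.parity_op_parity_op additive.minus[OF additive_incl] V.nop_minus_left)
  ultimately show ?thesis using enveloping_induct[of ?X x] by blast
qed

sublocale W: vertex_odd_operator sV grV dV brV vac nop E
  by unfold_locales (rule E_odd E_square)+

section \<open>Filtration of V by word length\<close>

primrec words :: "nat \<Rightarrow> 'b set" where
  "words 0 = {vac}"
| "words (Suc m) = words m \<union> {nop (\<iota> a) x |a x. (\<exists>p. a \<in> gr p) \<and> x \<in> words m}"

text \<open>Words have arbitrary homogeneous letters in any order, so that multiplying by a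
  generator raises the index by one without straightening. They are kept homogeneous because the
  Wick formula and quasi-associativity are stated for homogeneous elements.\<close>

definition filt :: "nat \<Rightarrow> 'b set" where
  "filt m = V.span (words m)"

lemma subspace_filt: "V.subspace (filt m)"
  by (simp add: filt_def)

lemma words_hom: "x \<in> words m \<Longrightarrow> \<exists>p. x \<in> grV p"
proof (induction m arbitrary: x)
  case 0
  then show ?case using V.vac_even by auto
next
  case (Suc m)
  then consider "x \<in> words m" | a p y where "a \<in> gr p" "y \<in> words m" "x = nop (\<iota> a) y" by auto
  then show ?case
  proof cases
    case 1 then show ?thesis by (rule Suc.IH)
  next
    case 2
    obtain q where "y \<in> grV q" using Suc.IH[OF 2(2)] by blast
    then show ?thesis using V.nop_parity[OF incl_gr[OF 2(1)]] 2(3) by blast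
  qed
qed

lemma words_filt: "x \<in> words m \<Longrightarrow> x \<in> filt m"
  by (simp add: filt_def V.span_base)

lemma nop_words: "a \<in> gr p \<Longrightarrow> x \<in> words m \<Longrightarrow> nop (\<iota> a) x \<in> words (Suc m)"
  by auto

lemma filt_induct: "x \<in> filt m \<Longrightarrow> V.subspace X \<Longrightarrow> (\<And>x. x \<in> words m \<Longrightarrow> x \<in> X) \<Longrightarrow> x \<in> X"
  unfolding filt_def using V.span_minimal by blast

lemma filt_Suc: "filt m \<subseteq> filt (Suc m)"
  unfolding filt_def by (rule V.span_mono) simp

lemma subspace_nop_vimage_left: "V.subspace X \<Longrightarrow> R.subspace {a. nop (\<iota> a) x \<in> X}"
  by (simp add: R.subspace_def V.subspace_def additive.zero[OF additive_incl] V.nop_zero_left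
    additive.add[OF additive_incl] V.nop_add_left linear_scale'[OF incl_lin] V.nop_scale_left)

lemma subspace_nop_vimage_right: "V.subspace X \<Longrightarrow> V.subspace {x. nop a x \<in> X}"
  by (simp add: V.subspace_def V.nop_zero_right V.nop_add_right V.nop_scale_right)

lemma nop_filt: "x \<in> filt m \<Longrightarrow> nop (\<iota> a) x \<in> filt (Suc m)"
proof -
  assume x: "x \<in> filt m"
  have "nop (\<iota> a) x \<in> filt (Suc m)" if "a \<in> gr p" for a p
    using filt_induct[OF x subspace_nop_vimage_right[OF subspace_filt], of "\<iota> a" "Suc m"]
      words_filt[OF nop_words[OF that]] by blast
  then show ?thesis
    using R.homogeneous_induct[OF subspace_nop_vimage_left[OF subspace_filt], of x "Suc m" a] by blast
qed

lemma d_words: "x \<in> words m \<Longrightarrow> dV x \<in> filt m"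
proof (induction m arbitrary: x)
  case (Suc m)
  then consider "x \<in> words m" | a y where "y \<in> words m" "x = nop (\<iota> a) y" by auto
  then show ?case
  proof cases
    case 1 then show ?thesis using Suc.IH filt_Suc by blast
  next
    case 2
    then show ?thesis
      using nop_filt[OF Suc.IH] nop_filt[OF words_filt] V.subspace_add[OF subspace_filt]
      by (simp add: V.d_derivation incl_d[symmetric])
  qed
qed (simp add: V.d_vac V.subspace_0[OF subspace_filt])

lemma subspace_d_vimage: "V.subspace X \<Longrightarrow> V.subspace {x. dV x \<in> X}"
  by (simp add: V.subspace_def additive.zero[OF V.additive_d] additive.add[OF V.additive_d]
    linear_scale'[OF V.d_lin])

lemma d_filt: "x \<in> filt m \<Longrightarrow> dV x \<in> filt m"
  using filt_induct[OF _ subspace_d_vimage[OF subspace_filt]] d_words by blast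

lemma subspace_coeff_br_vimage_left:
  "V.subspace X \<Longrightarrow> R.subspace {a. \<forall>n. coeff (brV (\<iota> a) x) n \<in> X}"
  by (simp add: R.subspace_def V.subspace_def additive.zero[OF additive_incl] V.br_zero_left
    additive.add[OF additive_incl] V.br_add_left linear_scale'[OF incl_lin] V.br_scale_left
    coeff_map_poly)

text \<open>In the Wick formula the first term replaces one letter by a bracket of letters, the
  second brackets the shorter word and restores the letter, and the integral even loses a
  letter.\<close>

lemma br_words: "a \<in> gr p \<Longrightarrow> x \<in> words m \<Longrightarrow> coeff (brV (\<iota> a) x) n \<in> filt m"
proof (induction m arbitrary: a p x n)
  case 0
  then show ?case by (simp add: V.br_vac_right V.subspace_0[OF subspace_filt])
next
  case (Suc m)
  have all: "coeff (brV (\<iota> c) y) n \<in> filt m" if "y \<in> words m" for c y n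
    using R.homogeneous_induct[OF subspace_coeff_br_vimage_left[OF subspace_filt], of y m c]
      Suc.IH that by blast
  consider "x \<in> words m" | b y q where "b \<in> gr q" "y \<in> words m" "x = nop (\<iota> b) y"
    using Suc.prems by auto
  then show ?case
  proof cases
    case 1 then show ?thesis using Suc filt_Suc by blast
  next
    case 2
    have "coeff (map_poly (\<lambda>x. nop x y) (brV (\<iota> a) (\<iota> b))) n \<in> filt (Suc m)"
      unfolding incl_br
      by (simp add: coeff_map_poly V.nop_zero_left additive.zero[OF additive_incl]
        nop_filt[OF words_filt[OF 2(2)]])
    moreover have "coeff (map_poly (nop (\<iota> b)) (brV (\<iota> a) y)) n \<in> filt (Suc m)"
      by (simp add: coeff_map_poly V.nop_zero_right nop_filt all 2)
    moreover have "coeff (pint_lambda sV (map_poly (\<lambda>x. brV x y) (brV (\<iota> a) (\<iota> b)))) n \<in> filt (Suc m)"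
      unfolding incl_br
      by (rule V.coeff_pint_lambda_mem[OF subspace_filt])
        (use all[OF 2(2)] filt_Suc in \<open>auto simp: coeff_map_poly V.br_zero_left additive.zero[OF additive_incl]\<close>)
    ultimately show ?thesis
      unfolding 2(3) V.wick[OF incl_gr[OF Suc.prems(1)] incl_gr[OF 2(1)]]
      by (simp add: coeff_psign V.subspace_add V.psign_mem subspace_filt)
  qed
qed

lemma br_filt_right: "a \<in> gr p \<Longrightarrow> x \<in> words m \<Longrightarrow> coeff (brV x (\<iota> a)) n \<in> filt m"
proof -
  assume a: "a \<in> gr p" and x: "x \<in> words m"
  obtain q where q: "x \<in> grV q" using words_hom[OF x] by blast
  have "coeff (V.skew_subst (brV (\<iota> a) x)) n \<in> filt m"
    by (rule V.coeff_skew_subst_mem[OF subspace_filt d_filt br_words[OF a x]])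
  then show ?thesis
    unfolding V.br_skew'[OF incl_gr[OF a] q]
    by (simp add: psign_def V.subspace_neg[OF subspace_filt])
qed

lemma nop_leibniz_incl: "W.nop_leibniz (\<iota> a)"
  by (simp add: W.nop_leibniz_def E_nop E_incl incl_parity_op)

lemma leibniz_incl_incl: "W.leibniz (\<iota> a) (\<iota> b)"
proof -
  have "map_poly E (brV (\<iota> a) (\<iota> b)) = map_poly \<iota> (map_poly D (br a b))"
    unfolding incl_br
    by (simp add: map_poly_comp additive.zero[OF additive_incl] additive.zero[OF additive_E] E_incl)
  then show ?thesis
    by (simp add: W.leibniz_def R_leibniz[unfolded R.leibniz_def] incl_br E_incl
      map_poly_add_poly[OF additive_incl] flip: incl_parity_op)
qed

lemma leibniz_vac: "W.leibniz a vac"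
  by (simp add: W.leibniz_def V.br_vac_right E_vac V.br_zero_right)

lemma leibniz_incl: "W.leibniz (\<iota> a) x"
proof -
  \<comment> \<open>The generator is quantified inside the set: the Wick formula brackets the
    coefficients of \<open>[\<iota> a \<^sub>\<lambda> \<iota> b]\<close>, which are other
    generators, with the same word.\<close>
  let ?X = "{x. \<forall>a. W.leibniz (\<iota> a) x}"
  have "nop (\<iota> b) y \<in> ?X" if b: "b \<in> gr q" and y: "y \<in> ?X" for b q y
  proof -
    have hom: "W.leibniz (\<iota> a) (nop (\<iota> b) y)" if a: "a \<in> gr p" for a p
    proof (rule W.leibniz_nop[OF incl_gr[OF a] incl_gr[OF b]])
      fix n
      have "coeff (brV (\<iota> a) (\<iota> b)) n = \<iota> (coeff (br a b) n)"
        unfolding incl_br by (simp add: coeff_map_poly additive.zero[OF additive_incl])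
      then show "W.nop_leibniz (coeff (brV (\<iota> a) (\<iota> b)) n)"
        "W.leibniz (coeff (brV (\<iota> a) (\<iota> b)) n) y"
        using nop_leibniz_incl y by simp_all
    qed (use y leibniz_incl_incl nop_leibniz_incl in auto)
    have "R.subspace {a. W.leibniz (\<iota> a) (nop (\<iota> b) y)}"
      using W.subspace_leibniz_left[of "nop (\<iota> b) y"]
      by (simp add: R.subspace_def V.subspace_def additive.zero[OF additive_incl]
        additive.add[OF additive_incl] linear_scale'[OF incl_lin])
    then have "W.leibniz (\<iota> a) (nop (\<iota> b) y)" for a
      using R.homogeneous_induct[of "{a. W.leibniz (\<iota> a) (nop (\<iota> b) y)}" a] hom by blast
    then show ?thesis by simp
  qed
  moreover have "V.subspace ?X"
    using W.subspace_leibniz_right by (simp add: V.subspace_def)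
  moreover have "vac \<in> ?X" by (simp add: leibniz_vac)
  ultimately have "x \<in> ?X" using enveloping_induct[of ?X x] by blast
  then show ?thesis by simp
qed

text \<open>The Leibniz rule for the product on \<open>filt (Suc m)\<close> uses the one for the bracket on \<open>filt m\<close>; the
  rule for the bracket on \<open>filt (Suc m)\<close> then uses the one for the product on \<open>filt (Suc m)\<close>.\<close>

lemma leibniz_filt: "x \<in> filt m \<Longrightarrow> W.nop_leibniz x \<and> W.leibniz x y"
proof (induction m arbitrary: x y)
  case 0
  have "W.nop_leibniz vac"
    by (simp add: W.nop_leibniz_def V.vac_left E_vac V.nop_zero_left parity_op_vac)
  moreover have "brV vac y = 0" for y
  proof -
    have "pCons 0 (brV vac y) = 0"
      using V.br_d_left[of vac y] by (simp add: V.d_vac V.br_zero_left)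
    then show ?thesis by simp
  qed
  then have "W.leibniz vac y" for y
    by (simp add: W.leibniz_def E_vac V.br_zero_left parity_op_vac)
  ultimately have "words 0 \<subseteq> {x. W.nop_leibniz x}" "words 0 \<subseteq> {x. W.leibniz x y}" by simp_all
  then show ?case
    using filt_induct[OF 0 W.subspace_nop_leibniz] filt_induct[OF 0 W.subspace_leibniz_left, of y]
    by blast
next
  case (Suc m)
  have wP: "W.nop_leibniz x" if "x \<in> words (Suc m)" for x
  proof -
    from that consider "x \<in> words m" | a z p where "a \<in> gr p" "z \<in> words m" "x = nop (\<iota> a) z" by auto
    then show ?thesis
    proof cases
      case 1 then show ?thesis using Suc.IH words_filt by blast
    next
      case 2
      obtain q where "z \<in> grV q" using words_hom[OF 2(2)] by blast
      then show ?thesis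
        unfolding 2(3) using Suc.IH words_filt[OF 2(2)]
        by (intro W.nop_leibniz_nop[OF incl_gr[OF 2(1)]]) (auto simp: nop_leibniz_incl leibniz_incl)
    qed
  qed
  have P: "W.nop_leibniz x" if "x \<in> filt (Suc m)" for x
    using filt_induct[OF that W.subspace_nop_leibniz] wP by blast
  \<comment> \<open>An inner induction on the right argument, uniform in \<open>x\<close>: the
    bracket of a word \<open>x\<close> with a generator has coefficients that stay in
    \<open>filt (Suc m)\<close> by \<open>br_filt_right\<close>, so both the product rule
    \<open>P\<close> and the hypothesis on \<open>y\<close> apply to them.\<close>
  let ?X = "{y. \<forall>x\<in>filt (Suc m). W.leibniz x y}"
  have "V.subspace ?X"
    using W.subspace_leibniz_right by (simp add: V.subspace_def)
  moreover have "vac \<in> ?X" by (simp add: leibniz_vac)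
  moreover have "nop (\<iota> a) y \<in> ?X" if a: "a \<in> gr p" and y: "y \<in> ?X" for a y p
  proof -
    have "W.leibniz x (nop (\<iota> a) y)" if x: "x \<in> words (Suc m)" for x
    proof -
      obtain q where q: "x \<in> grV q" using words_hom[OF x] by blast
      show ?thesis
        using y words_filt[OF x] br_filt_right[OF a x] P
        by (intro W.leibniz_nop[OF q incl_gr[OF a]] W.leibniz_skew[OF incl_gr[OF a] q])
          (auto simp: leibniz_incl nop_leibniz_incl)
    qed
    then have "W.leibniz x (nop (\<iota> a) y)" if "x \<in> filt (Suc m)" for x
      using filt_induct[OF that W.subspace_leibniz_left, of "nop (\<iota> a) y"] by blast
    then show ?thesis by simp
  qed
  ultimately have "y \<in> ?X" using enveloping_induct[of ?X y] by blast
  then show ?case using P Suc.prems by blast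
qed

lemma in_span_words: "x \<in> V.span (\<Union>m. words m)"
proof (rule enveloping_induct)
  show "V.subspace (V.span (\<Union>m. words m))" by simp
  have "vac \<in> words 0" by simp
  then show "vac \<in> V.span (\<Union>m. words m)" by (rule V.span_base[OF UN_I[OF UNIV_I]])
  fix p a x assume a: "a \<in> gr p" and x: "x \<in> V.span (\<Union>m. words m)"
  have "(\<Union>m. words m) \<subseteq> {x. nop (\<iota> a) x \<in> V.span (\<Union>m. words m)}"
  proof clarify
    fix x m assume "x \<in> words m"
    then have "nop (\<iota> a) x \<in> words (Suc m)" by (rule nop_words[OF a])
    then show "nop (\<iota> a) x \<in> V.span (\<Union>m. words m)" by (rule V.span_base[OF UN_I[OF UNIV_I]])
  qed
  then show "nop (\<iota> a) x \<in> V.span (\<Union>m. words m)"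
    using V.span_minimal[OF _ subspace_nop_vimage_right[OF V.subspace_span]] x by blast
qed

lemma nop_leibniz_all: "W.nop_leibniz x"
proof -
  have "(\<Union>m. words m) \<subseteq> {x. W.nop_leibniz x}"
    using leibniz_filt[OF words_filt] by auto
  from V.span_minimal[OF this W.subspace_nop_leibniz] show ?thesis
    using in_span_words[of x] by auto
qed

lemma leibniz_all: "W.leibniz x y"
proof -
  have "(\<Union>m. words m) \<subseteq> {x. W.leibniz x y}"
    using leibniz_filt[OF words_filt] by auto
  from V.span_minimal[OF this W.subspace_leibniz_left] show ?thesis
    using in_span_words[of x] by auto
qed

end

theorem (in enveloping_extension) n1_susy: "is_n1_susy_with sV grV dV brV vac nop E"
  unfolding is_n1_susy_with_def
  by (rule conjI[OF V.vertex_algebra_axioms W.n1_susy_of_leibniz[OF nop_leibniz_all leibniz_all]])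

context enveloping_odd_derivation
begin

text \<open>Brings an arbitrary odd derivation extending \<open>D\<close> into the form with
  generators on the left, on which uniqueness and the SUSY axioms are based.\<close>

lemma extensionI:
  assumes "odd_derivation sV grV nop E" and E: "\<And>x. E (\<iota> x) = \<iota> (D x)"
  shows "enveloping_extension s gr d br sV grV dV brV vac nop \<iota> D E"
proof (intro enveloping_extension.intro enveloping_extension_axioms.intro)
  show "enveloping_odd_derivation s gr d br sV grV dV brV vac nop \<iota> D"
    by (rule enveloping_odd_derivation_axioms)
  have lin: "Vector_Spaces.linear sV sV E"
    and der: "\<And>p a b. a \<in> grV p \<Longrightarrow> E (nop a b) = nop (E a) b + psign p (nop a (E b))"
    using assms by (auto simp: odd_derivation_def linear_of_parity_def)
  show "Vector_Spaces.linear sV sV E" by (rule lin)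
  show "E vac = 0"
    using der[OF V.vac_even, of vac] by (simp add: V.vac_left V.vac_right psign_def)
  fix a x
  let ?X = "{a. E (nop (\<iota> a) x) = nop (\<iota> (D a)) x + nop (\<iota> (\<sigma> a)) (E x)}"
  have "a \<in> ?X"
  proof (rule R.homogeneous_induct)
    note nop = additive_comp[OF V.additive_nop_left additive_incl]
    show "R.subspace ?X"
      by (rule R.subspace_additive_eq[where h = sV, OF additive_comp[OF linear_additive[OF lin] nop]
          additive_plus[OF additive_comp[OF nop R.additive_D] additive_comp[OF nop R.additive_parity_op]]])
        (simp_all add: linear_scale'[OF incl_lin] linear_scale'[OF lin] linear_scale'[OF R.D_lin]
          linear_scale'[OF R.parity_op_linear] V.nop_scale_left V.scale_right_distrib)
    fix p a assume "a \<in> gr p"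
    then show "a \<in> ?X"
      using der[OF incl_gr] by (simp add: E incl_parity_op V.parity_op_hom[OF incl_gr] V.nop_psign_left)
  qed
  then show "E (nop (\<iota> a) x) = nop (\<iota> (D a)) x + nop (\<iota> (\<sigma> a)) (E x)" by simp
qed

lemma extension_unique:
  assumes "enveloping_extension s gr d br sV grV dV brV vac nop \<iota> D E"
    and "enveloping_extension s gr d br sV grV dV brV vac nop \<iota> D E'"
  shows "E = E'"
proof
  fix x
  interpret A: enveloping_extension s gr d br sV grV dV brV vac nop \<iota> D E by fact
  interpret B: enveloping_extension s gr d br sV grV dV brV vac nop \<iota> D E' by fact
  have "V.subspace {x. E x = E' x}"
    by (rule V.subspace_additive_eq[where h = sV, OF A.additive_E B.additive_E])
      (simp_all add: linear_scale'[OF A.E_lin] linear_scale'[OF B.E_lin])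
  then have "x \<in> {x. E x = E' x}"
    by (rule enveloping_induct) (simp_all add: A.E_vac B.E_vac A.E_nop B.E_nop)
  then show "E x = E' x" by simp
qed

text \<open>The first conjunct justifies speaking of the extension of \<open>D\<close> and ensures
  that the second is not vacuous.\<close>

theorem extension_ex1_and_susy:
  "(\<exists>!E. odd_derivation sV grV nop E \<and> (\<forall>x. E (\<iota> x) = \<iota> (D x))) \<and>
    (\<forall>E. odd_derivation sV grV nop E \<and> (\<forall>x. E (\<iota> x) = \<iota> (D x)) \<longrightarrow>
      is_n1_susy_with sV grV dV brV vac nop E)"
proof -
  obtain E where E: "Vector_Spaces.linear sV sV E" "E vac = 0"
    "\<And>a x. E (nop (\<iota> a) x) = nop (\<iota> (D a)) x + nop (\<iota> (\<sigma> a)) (E x)"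
    using enveloping_derivation_exists by blast
  interpret enveloping_extension s gr d br sV grV dV brV vac nop \<iota> D E
    by (intro enveloping_extension.intro enveloping_extension_axioms.intro
      enveloping_odd_derivation_axioms E)
  have "odd_derivation sV grV nop E"
    unfolding odd_derivation_def using E_odd nop_leibniz_all W.nop_leibniz_hom by blast
  then have ex: "\<exists>E. odd_derivation sV grV nop E \<and> (\<forall>x. E (\<iota> x) = \<iota> (D x))"
    using E_incl by blast
  moreover have ext: "enveloping_extension s gr d br sV grV dV brV vac nop \<iota> D E"
    if "odd_derivation sV grV nop E \<and> (\<forall>x. E (\<iota> x) = \<iota> (D x))" for E
    by (rule extensionI) (use that in simp_all)
  moreover have "E = E'"
    if "odd_derivation sV grV nop E \<and> (\<forall>x. E (\<iota> x) = \<iota> (D x))"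
      "odd_derivation sV grV nop E' \<and> (\<forall>x. E' (\<iota> x) = \<iota> (D x))" for E E'
    by (rule extension_unique[OF ext[OF that(1)] ext[OF that(2)]])
  moreover have "is_n1_susy_with sV grV dV brV vac nop E"
    if "odd_derivation sV grV nop E \<and> (\<forall>x. E (\<iota> x) = \<iota> (D x))" for E
    by (rule enveloping_extension.n1_susy[OF ext[OF that]])
  ultimately show ?thesis by (intro conjI allI impI ex_ex1I)
qed

end

text \<open>The generators \<open>S \<union> D S\<close> and the centre generate the algebra as a \<open>\<complex>[\<partial>]\<close>-module, so the Leibniz rule,
  which is linear and compatible with \<open>\<partial>\<close>, need only be checked on them.\<close>

lemma (in odd_operator) leibniz_generated:
  assumes S: "supersymmetric_generator gr br D S"
    and C: "graded_subspace s gr C" "\<And>c x. c \<in> C \<Longrightarrow> br c x = 0" "\<And>c. c \<in> C \<Longrightarrow> D c = 0"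
    and gen: "\<And>X. subspace X \<Longrightarrow> (\<And>x. x \<in> X \<Longrightarrow> d x \<in> X) \<Longrightarrow> S \<union> D ` S \<union> C \<subseteq> X \<Longrightarrow> X = UNIV"
  shows "leibniz a b"
proof -
  have central: "leibniz c x" "leibniz x c" if "c \<in> C" for c x
    using leibniz_central[OF C(1) that] C(2,3) that by blast+
  have "leibniz x b" if x: "x \<in> S \<union> D ` S" for x b
  proof -
    have "S \<union> D ` S \<union> C \<subseteq> {b. leibniz x b}"
      using x leibniz_generator[OF S] central by auto
    from gen[OF subspace_leibniz_right _ this] show ?thesis using leibniz_d_right by blast
  qed
  then have "S \<union> D ` S \<union> C \<subseteq> {a. leibniz a b}"
    using central by auto
  from gen[OF subspace_leibniz_left _ this] show ?thesis using leibniz_d_left by blast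
qed

theorem proposition5p4:
  fixes s :: "complex \<Rightarrow> 'r::ab_group_add \<Rightarrow> 'r" and gr :: "bit \<Rightarrow> 'r set"
    and d :: "'r \<Rightarrow> 'r" and br :: "'r \<Rightarrow> 'r \<Rightarrow> 'r poly"
    and R Rbar EC :: "'r set" and D :: "'r \<Rightarrow> 'r"
    and I J Jbar :: "'i set" and u v :: "'i \<Rightarrow> 'r" and par :: "'i \<Rightarrow> bit"
    and sV :: "complex \<Rightarrow> 'v::ab_group_add \<Rightarrow> 'v" and grV :: "bit \<Rightarrow> 'v set"
    and dV :: "'v \<Rightarrow> 'v" and brV :: "'v \<Rightarrow> 'v \<Rightarrow> 'v poly"
    and vac :: 'v and nop :: "'v \<Rightarrow> 'v \<Rightarrow> 'v" and \<iota> :: "'r \<Rightarrow> 'v"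
  assumes "lie_conformal_algebra s gr d br"
    and "lie_conformal_subalgebra s gr d br R"
    and "d_free s d u I"
    and "internal_direct_sum R (d_span s d u I) EC"
    and "graded_subspace s gr EC"
    and "\<And>c. c \<in> EC \<Longrightarrow> d c = 0"
    and "\<And>c x. c \<in> EC \<Longrightarrow> br c x = 0"
    and "J \<union> Jbar = I" and "J \<inter> Jbar = {}"
    and "d_free s d v I"
    and "Rbar = d_span s d v I"
    and "internal_direct_sum UNIV R Rbar"
    and "\<And>i. i \<in> I \<Longrightarrow> u i \<in> gr (par i)"
    and "\<And>i. i \<in> I \<Longrightarrow> v i \<in> gr (1 - par i)"
    and "linear_of_parity 1 s gr s gr D"
    and "\<And>x. D (D x) + D (D x) = s 2 (d x)"
    and "\<And>j. j \<in> J \<Longrightarrow> D (u j) = v j"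
    and "\<And>j. j \<in> Jbar \<Longrightarrow> D (v j) = u j"
    and "\<And>c. c \<in> EC \<Longrightarrow> D c = 0"
    and "supersymmetric_generator gr br D (u ` J \<union> v ` Jbar)"
    and "universal_enveloping_vertex_algebra s gr d br sV grV dV brV vac nop \<iota>"
  shows "(\<exists>!DV. odd_derivation sV grV nop DV \<and> (\<forall>x. DV (\<iota> x) = \<iota> (D x))) \<and>
    (\<forall>DV. odd_derivation sV grV nop DV \<and> (\<forall>x. DV (\<iota> x) = \<iota> (D x)) \<longrightarrow>
      is_n1_susy_with sV grV dV brV vac nop DV)"
proof -
  interpret L: lie_conformal_algebra s gr d br by fact
  have "D (D x) = d x" for x
  proof -
    have "s 2 (D (D x)) = s 2 (d x)"
      using assms(16)[of x] L.scale_left_distrib[of 1 1 "D (D x)"] by simp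
    then show ?thesis by simp
  qed
  then interpret R: odd_operator s gr d br D
    using assms(15) by unfold_locales
  have "R.leibniz a b" for a b
  proof (rule R.leibniz_generated[OF assms(20) assms(5)])
    show "br c x = 0" if "c \<in> EC" for c x using assms(7) that .
    show "D c = 0" if "c \<in> EC" for c using assms(19) that .
    fix X assume X: "L.subspace X" and d: "\<And>x. x \<in> X \<Longrightarrow> d x \<in> X"
      and gens: "(u ` J \<union> v ` Jbar) \<union> D ` (u ` J \<union> v ` Jbar) \<union> EC \<subseteq> X"
    have d_span: "d_span s d w I \<subseteq> X" if "\<And>i. i \<in> I \<Longrightarrow> w i \<in> X" for w
    proof -
      have "(d ^^ n) (w i) \<in> X" if "i \<in> I" for i n
        by (induction n) (use \<open>\<And>i. i \<in> I \<Longrightarrow> w i \<in> X\<close>[OF that] d in auto)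
      then show ?thesis unfolding d_span_def by (intro L.span_minimal X) auto
    qed
    \<comment> \<open>Each index contributes one of u_i, v_i to the generators, and D yields the
      other; \<open>J\<close> and \<open>Jbar\<close> exchange the roles.\<close>
    have uv: "u i \<in> X" "v i \<in> X" if i: "i \<in> I" for i
    proof -
      consider "i \<in> J" | "i \<in> Jbar" using i assms(8) by blast
      then have "u i \<in> X \<and> v i \<in> X"
      proof cases
        case 1
        then have "u i \<in> X" "D (u i) \<in> X" using gens by auto
        then show ?thesis using assms(17)[OF 1] by simp
      next
        case 2
        then have "v i \<in> X" "D (v i) \<in> X" using gens by auto
        then show ?thesis using assms(18)[OF 2] by simp
      qed
      then show "u i \<in> X" "v i \<in> X" by simp_all
    qed
    have "d_span s d u I \<subseteq> X" "d_span s d v I \<subseteq> X"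
      by (rule d_span, erule uv)+
    then have span: "x \<in> X" if "x \<in> d_span s d u I \<or> x \<in> d_span s d v I" for x
      using that by blast
    have "x \<in> X" for x
    proof -
      obtain y z where "x = y + z" "y \<in> R" "z \<in> Rbar"
        using assms(12) unfolding internal_direct_sum_def by blast
      moreover from \<open>y \<in> R\<close> obtain y' c where "y = y' + c" "y' \<in> d_span s d u I" "c \<in> EC"
        using assms(4) unfolding internal_direct_sum_def by blast
      ultimately show ?thesis
        using assms(11) span gens by (auto intro!: L.subspace_add[OF X])
    qed
    then show "X = UNIV" by blast
  qed
  then interpret U: enveloping_odd_derivation s gr d br sV grV dV brV vac nop \<iota> D
    using assms(21) R.odd_operator_axioms
    by (intro enveloping_odd_derivation.intro enveloping_odd_derivation_axioms.intro)
  show ?thesis by (rule U.extension_ex1_and_susy)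
qed

end
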